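(* Assume Conjecture H (as defined in the context) holds. Let $\lambda$ be any positive constant, and let $d = d(x)$ be a function of $x$ taking positive even integer values such that $d \sim \lambda \log x$ as $x \to \infty$. Then, as $x \to \infty$, \[ N(x, d) \sim e^{-\lambda}\, \mathfrak{S}(d)\, \frac{x}{(\log x)^2}. \]
   Context: Let $p_n$ denote the $n$th prime number. For a positive integer $d$ and real $x$, define \[ N(x,d) = \#\{ n \geq 1 : p_{n+1} \leq x,\ p_{n+1} - p_n = d \}, \] the number of pairs of consecutive primes up to $x$ differing by $d$. For a positive integer $d$, define \[ \mathfrak{S}(d) = \begin{cases} 2 C_2 \displaystyle\prod_{\substack{p \mid d \\ p > 2}} \frac{p-1}{p-2}, & d \text{ even},\\ 0, & d \text{ odd},\end{cases} \qquad C_2 = \prod_{p > 2}\left(1 - \frac{1}{(p-1)^2}\right), \] where the products run over primes $p$. For a set $\mathcal{H} = \{h_1, \ldots, h_k\}$ of $k$ distinct integers, let $\pi(x;\mathcal{H})$ be the number of positive integers $n \leq x$ such that $n + h_1, \ldots, n + h_k$ are all prime. Let $\nu_{\mathcal{H}}(p)$ be the number of distinct residue classes modulo $p$ occupied by the elements of $\mathcal{H}$, and define the singular series \[ \mathfrak{S}(\mathcal{H}) = \prod_{p} \left(1 - \frac{1}{p}\right)^{-k}\left(1 - \frac{\nu_{\mathcal{H}}(p)}{p}\right). \] $\mathcal{H}$ is called admissible if $\nu_{\mathcal{H}}(p) < p$ for every prime $p$. Conjecture H (a form of the Hardy–Littlewood prime $k$-tuple conjecture): for each fixed integer $k \geq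 2$ and each admissible set $\mathcal{H}$ of $k$ distinct integers, \[ \pi(x;\mathcal{H}) = \mathfrak{S}(\mathcal{H}) \frac{x}{(\log x)^k}\,(1 + o_k(1)), \] uniformly for all admissible $\mathcal{H} \subset [1, h]$, where $h = h(x) \sim \lambda \log x$ as $x \to \infty$ and $\lambda$ is a positive constant (here taken to be the constant $\lambda$ of the claim). *)

theory Defs
  imports
    "HOL-Analysis.Infinite_Products"
    "HOL-Library.Landau_Symbols"
    "HOL-Library.Infinite_Set"
    "HOL-Computational_Algebra.Primes"
begin

(* enumerate counts from 0, whereas the primes are indexed from 1: nth_prime 1 = 2.
   The value at 0 is not used. *)
definition nth_prime :: "nat \<Rightarrow> nat" where
  "nth_prime n = enumerate {p. prime p} (n - 1)"

definition gap_count :: "real \<Rightarrow> nat \<Rightarrow> nat" where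
  "gap_count x d =
     card {n. n \<ge> 1 \<and> real (nth_prime (n + 1)) \<le> x \<and>
              int (nth_prime (n + 1)) - int (nth_prime n) = int d}"

(* Infinite products over primes are products over all natural numbers, in increasing order,
   with factor 1 at the non-primes. *)

definition twin_prime_const :: real where
  "twin_prime_const = (\<Prod>p. if prime p \<and> p > 2 then 1 - 1 / (real p - 1)\<^sup>2 else 1)"

definition pair_singular_series :: "nat \<Rightarrow> real" where
  "pair_singular_series d =
     (if even d
      then 2 * twin_prime_const *
           (\<Prod>p | prime p \<and> p dvd d \<and> p > 2. (real p - 1) / (real p - 2))
      else 0)"

definition tuple_count :: "real \<Rightarrow> int set \<Rightarrow> nat" where
  "tuple_count x H = card {n::nat. n \<ge> 1 \<and> real n \<le> x \<and> (\<forall>h\<in>H. prime (int n + h))}"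

definition residue_count :: "int set \<Rightarrow> nat \<Rightarrow> nat" where
  "residue_count H p = card ((\<lambda>h. h mod int p) ` H)"

definition admissible :: "int set \<Rightarrow> bool" where
  "admissible H \<longleftrightarrow> (\<forall>p. prime p \<longrightarrow> residue_count H p < p)"

definition singular_series :: "int set \<Rightarrow> real" where
  "singular_series H =
     (\<Prod>p. if prime p
           then (1 - 1 / real p) powi (- int (card H)) * (1 - real (residue_count H p) / real p)
           else 1)"

(* The relative error tends to 0 for each fixed k and each fixed function h, uniformly in the
   admissible k-element sets H of integers in [1, h(x)]. *)
definition conjecture_H :: "real \<Rightarrow> bool" where
  "conjecture_H lam \<longleftrightarrow>
     (\<forall>k\<ge>2. \<forall>h :: real \<Rightarrow> real. h \<sim>[at_top] (\<lambda>x. lam * ln x) \<longrightarrow>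
        (\<forall>\<epsilon>>0. \<forall>\<^sub>F x in at_top.
           \<forall>H. finite H \<and> card H = k \<and> admissible H \<and> (\<forall>a\<in>H. 1 \<le> a \<and> real_of_int a \<le> h x) \<longrightarrow>
             (\<exists>\<delta>. \<bar>\<delta>\<bar> \<le> \<epsilon> \<and>
                real (tuple_count x H) = singular_series H * (x / ln x ^ k) * (1 + \<delta>))))"

end

theory Submission
  imports Defs "HOL-Analysis.Analysis"
begin

text \<open>
  For a set \<open>A\<close> of integers and \<open>h \<notin> A\<close>, the quotient \<open>\<SS>(A \<union> {h}) / \<SS>(A)\<close> is a product over primes of
  local factors whose mean over the residues of \<open>h\<close> modulo \<open>p\<close> is exactly 1. By the Chinese remainder
  theorem the product over \<open>p \<le> y\<close> therefore has mean \<open>1 + o(1)\<close> over \<open>1 \<le> h \<le> N\<close>. The factors with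
  \<open>p > y\<close> exceed 1 only if \<open>p\<close> divides some \<open>h - a\<close> with \<open>a \<in> A\<close>, and then by at most \<open>p / (p - 1)\<close>,
  which contributes \<open>O(1 / y)\<close> on average, against a truncated product of size \<open>O(\<surd>y)\<close>; from below they
  are \<open>1 - O(1 / p\<^sup>2)\<close>. Hence \<open>\<Sum>\<^sub>h \<SS>(A \<union> {h}) = (1 + o(1)) N \<SS>(A)\<close> uniformly in \<open>A \<subseteq> {1..N}\<close> of
  given size, and iterating from \<open>{1, N}\<close> gives the mean of \<open>\<SS>\<close> over the \<open>(k+2)\<close>-sets with extreme
  elements 1 and \<open>N\<close>. With \<open>N = d + 1\<close>, Conjecture H and this mean evaluate every term of the Bonferroni
  inequalities for the number of prime pairs at distance \<open>d\<close> without a prime in between; the terms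
  tend to \<open>(-\<lambda>)\<^sup>k / k!\<close>. Inadmissible sets are negligible because one element of such a tuple of primes
  is a fixed prime.
\<close>

section \<open>The singular series as a limit of finite products\<close>

definition primes_upto :: "nat \<Rightarrow> nat set" where
  "primes_upto n = {p. prime p \<and> p \<le> n}"

definition local_factor :: "int set \<Rightarrow> nat \<Rightarrow> real" where
  "local_factor A p =
     (1 - 1 / real p) powi (- int (card A)) * (1 - real (residue_count A p) / real p)"

definition partial_series :: "int set \<Rightarrow> nat \<Rightarrow> real" where
  "partial_series A n = (\<Prod>p\<in>primes_upto n. local_factor A p)"

lemma finite_primes_upto [simp, intro]: "finite (primes_upto n)"
  by (rule finite_subset[of _ "{..n}"]) (auto simp: primes_upto_def)

lemma prod_if_prime_eq:
  "(\<Prod>p\<le>n. if prime p then f p else 1) = (\<Prod>p\<in>primes_upto n. f p :: 'a :: comm_monoid_mult)"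
proof -
  have "primes_upto n = {p\<in>{..n}. prime p}" by (auto simp: primes_upto_def)
  thus ?thesis using prod.inter_filter[of "{..n}" f prime] by simp
qed

lemma residue_count_le_card: "finite A \<Longrightarrow> residue_count A p \<le> card A"
  unfolding residue_count_def by (rule card_image_le)

lemma residue_count_le: "p > 0 \<Longrightarrow> residue_count A p \<le> p"
proof -
  assume p: "p > 0"
  have "(\<lambda>h. h mod int p) ` A \<subseteq> {0..<int p}" using p by auto
  hence "card ((\<lambda>h. h mod int p) ` A) \<le> card {0..<int p}" by (intro card_mono) auto
  thus ?thesis by (simp add: residue_count_def)
qed

text \<open>Two distinct elements differ by at most twice the largest absolute value in
  \<open>A\<close>, so no prime beyond that can identify them.\<close>

lemma eventually_residue_count_eq_card:
  assumes "finite A"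
  shows "\<forall>\<^sub>F p in sequentially. residue_count A p = card A"
proof -
  obtain M where M: "\<And>a. a \<in> A \<Longrightarrow> \<bar>a\<bar> \<le> M"
    using finite_imageI[OF assms, of abs] by (metis Max_ge image_eqI)
  have "residue_count A p = card A" if p: "int p > 2 * M" "p > 0" for p
  proof -
    have "inj_on (\<lambda>h. h mod int p) A"
    proof (rule inj_onI)
      fix a b assume ab: "a \<in> A" "b \<in> A" "a mod int p = b mod int p"
      hence "int p dvd a - b" by (simp add: mod_eq_dvd_iff)
      moreover have "\<bar>a - b\<bar> < int p" using M[OF ab(1)] M[OF ab(2)] p by linarith
      ultimately show "a = b" using dvd_imp_le_int[of "a - b" "int p"] by fastforce
    qed
    thus ?thesis by (simp add: residue_count_def card_image)
  qed
  moreover have "\<forall>\<^sub>F p in sequentially. p \<ge> nat (2 * M) + 1" by (rule eventually_ge_at_top)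
  ultimately show ?thesis by (elim eventually_mono) (auto simp: nat_less_iff)
qed

lemma power_int_uminus_of_nat: "(x :: real) powi (- int k) = inverse (x ^ k)"
  by (simp add: power_int_minus)

text \<open>This is the local factor at a prime where \<open>k\<close> elements lie in
  \<open>k\<close> distinct classes. The upper bound is Bernoulli's inequality for
  \<open>(1 - 1/p)^k\<close>. For the lower one, \<open>1 / (1 - 1/p)\<close> is at least
  \<open>1 + 1/p\<close>, so Bernoulli gives the factor \<open>1 + k/p\<close>, and
  \<open>(1 + k/p) * (1 - k/p)\<close> is \<open>1 - k^2/p^2\<close>. The deviation from 1 is thus
  summable over the primes.\<close>

lemma generic_factor_bounds:
  fixes p :: real
  assumes "p \<ge> 2" "p \<ge> real k"
  shows "inverse ((1 - 1 / p) ^ k) * (1 - real k / p) \<le> 1"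
    and "1 - (real k)\<^sup>2 / p\<^sup>2 \<le> inverse ((1 - 1 / p) ^ k) * (1 - real k / p)"
proof -
  have p0: "p > 0" using assms by simp
  have pos: "(1 - 1 / p) ^ k > 0" using assms by simp
  have "1 + real k * (- (1 / p)) \<le> (1 + (- (1/p))) ^ k"
    by (rule Bernoulli_inequality) (use assms in \<open>simp add: field_simps\<close>)
  thus "inverse ((1 - 1 / p) ^ k) * (1 - real k / p) \<le> 1"
    using pos by (simp add: field_simps)
  have a: "1 + real k * (1 / p) \<le> (1 + 1 / p) ^ k"
    by (rule Bernoulli_inequality) (use assms in \<open>simp add: field_simps\<close>)
  have "1 + 1 / p \<le> inverse (1 - 1 / p)" using assms by (simp add: field_simps)
  hence "(1 + 1 / p) ^ k \<le> inverse (1 - 1 / p) ^ k" using p0 by (intro power_mono) auto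
  with a have b: "1 + real k / p \<le> inverse ((1 - 1 / p) ^ k)" by (simp add: power_inverse)
  have "1 - real k / p \<ge> 0" using assms p0 by (simp add: field_simps)
  from mult_right_mono[OF b this]
  show "1 - (real k)\<^sup>2 / p\<^sup>2 \<le> inverse ((1 - 1 / p) ^ k) * (1 - real k / p)"
    by (simp add: algebra_simps power2_eq_square)
qed

lemma convergent_prod_local_factor:
  assumes "finite A"
  shows "convergent_prod (\<lambda>p. if prime p then local_factor A p else 1)"
proof -
  define k where "k = card A"
  let ?g = "\<lambda>p. if prime p then local_factor A p else 1"
  have ev: "\<forall>\<^sub>F p in sequentially. norm (?g p - 1) \<le> (real k)\<^sup>2 * inverse (real p ^ 2)"
    using eventually_residue_count_eq_card[OF assms] eventually_ge_at_top[of "max 2 k"]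
  proof eventually_elim
    case (elim p)
    hence p: "real p \<ge> 2" "real p \<ge> real k" by auto
    show ?case
      using generic_factor_bounds[OF p] elim(1)
      by (auto simp: local_factor_def power_int_uminus_of_nat k_def[symmetric] divide_inverse)
  qed
  have "summable (\<lambda>p. (real k)\<^sup>2 * inverse (real p ^ 2))"
    by (intro summable_mult inverse_power_summable) auto
  hence "summable (\<lambda>p. norm (?g p - 1))"
    by (rule summable_comparison_test_ev[rotated]) (use ev in auto)
  thus ?thesis
    by (intro abs_convergent_prod_imp_convergent_prod) (simp add: abs_convergent_prod_conv_summable)
qed

lemma partial_series_tendsto:
  assumes "finite A"
  shows "partial_series A \<longlonglongrightarrow> singular_series A"
proof -
  have "singular_series A = prodinf (\<lambda>p. if prime p then local_factor A p else 1)"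
    unfolding singular_series_def local_factor_def ..
  thus ?thesis
    using convergent_prod_LIMSEQ[OF convergent_prod_local_factor[OF assms]]
    by (simp add: prod_if_prime_eq partial_series_def[abs_def])
qed

lemma local_factor_nonneg: "prime p \<Longrightarrow> local_factor A p \<ge> 0"
  using residue_count_le[of p A] prime_gt_1_nat[of p]
  by (auto simp: local_factor_def power_int_uminus_of_nat intro!: mult_nonneg_nonneg)

lemma partial_series_nonneg: "partial_series A n \<ge> 0"
  unfolding partial_series_def
  by (intro prod_nonneg) (auto simp: primes_upto_def intro: local_factor_nonneg)

lemma singular_series_nonneg: "finite A \<Longrightarrow> singular_series A \<ge> 0"
  by (rule LIMSEQ_le_const[OF partial_series_tendsto]) (auto intro: partial_series_nonneg)

text \<open>If the elements fill every class modulo some prime \<open>p\<close>, the factor at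
  \<open>p\<close> is 0, and every truncation beyond \<open>p\<close> vanishes.\<close>

lemma singular_series_eq_0:
  assumes "finite A" "\<not> admissible A"
  shows "singular_series A = 0"
proof -
  obtain p where p: "prime p" "\<not> residue_count A p < p" using assms by (auto simp: admissible_def)
  with residue_count_le[of p A] have "residue_count A p = p" using prime_gt_0_nat by fastforce
  with p(1) have 0: "local_factor A p = 0" using prime_gt_0_nat[of p] by (simp add: local_factor_def)
  have "\<forall>\<^sub>F n in sequentially. partial_series A n = 0"
    using eventually_ge_at_top[of p]
    by eventually_elim (use p 0 in \<open>auto simp: partial_series_def primes_upto_def intro!: prod_zero\<close>)
  hence "partial_series A \<longlonglongrightarrow> 0" by (rule tendsto_eventually)
  with partial_series_tendsto[OF assms(1)] show ?thesis by (rule LIMSEQ_unique)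
qed

section \<open>Adjoining one element\<close>

text \<open>
  The quotient of the local factors at \<open>p\<close> of \<open>insert h A\<close> and of \<open>A\<close>.
\<close>

definition ext_factor :: "int set \<Rightarrow> nat \<Rightarrow> int \<Rightarrow> real" where
  "ext_factor A p h =
     (if h mod int p \<in> (\<lambda>a. a mod int p) ` A then real p / (real p - 1)
      else real p * (real p - residue_count A p - 1)
           / ((real p - 1) * (real p - residue_count A p)))"

lemma residue_count_insert:
  assumes "finite A"
  shows "residue_count (insert h A) p =
    (if h mod int p \<in> (\<lambda>a. a mod int p) ` A then residue_count A p else residue_count A p + 1)"
  using assms by (simp add: residue_count_def insert_absorb)

text \<open>One more element brings the extra factor \<open>p / (p - 1)\<close> from the power, and
  raises the number of occupied classes by one unless \<open>h\<close> falls into a class already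
  taken. That some class is free keeps the divisor \<open>p - residue_count A p\<close> away from
  0.\<close>

lemma local_factor_insert:
  assumes "finite A" "h \<notin> A" "prime p" "residue_count A p < p"
  shows "local_factor (insert h A) p = local_factor A p * ext_factor A p h"
proof -
  define P v where "P = real p" and "v = real (residue_count A p)"
  have P: "P > 1" "P - v > 0" using prime_gt_1_nat[OF assms(3)] assms(4) by (auto simp: P_def v_def)
  define X where "X = inverse ((1 - 1 / P) ^ card A)"
  have pw: "(1 - 1 / P) powi (- int (card (insert h A))) = X * (P / (P - 1))"
    unfolding power_int_uminus_of_nat using assms(1,2) P by (simp add: X_def field_simps)
  have pw': "(1 - 1 / P) powi (- int (card A)) = X"
    unfolding power_int_uminus_of_nat X_def ..
  show ?thesis
  proof (cases "h mod int p \<in> (\<lambda>a. a mod int p) ` A")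
    case True
    thus ?thesis
      unfolding local_factor_def ext_factor_def P_def[symmetric] pw pw'
      by (simp add: residue_count_insert[OF assms(1)])
  next
    case False
    have "P / (P - 1) * (1 - (v + 1) / P)
          = (1 - v / P) * (P * (P - v - 1) / ((P - 1) * (P - v)))"
      using P by (simp add: divide_simps)
    hence "X * (P / (P - 1)) * (1 - (v + 1) / P)
          = X * (1 - v / P) * (P * (P - v - 1) / ((P - 1) * (P - v)))"
      by (simp only: mult.assoc)
    thus ?thesis
      unfolding local_factor_def ext_factor_def P_def[symmetric] pw pw'
      using False by (simp only: residue_count_insert[OF assms(1)] v_def if_False of_nat_add of_nat_1)
  qed
qed

text \<open>With \<open>P\<close> for the prime and \<open>v\<close> for the number of occupied
  classes, \<open>P * (P - v - 1)\<close> equals \<open>(P - 1) * (P - v) - v\<close>. In this form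
  the factor is visibly at most 1 and within order \<open>v / P^2\<close> of it.\<close>

lemma ext_factor_eq_of_not_mem:
  assumes "prime p" "residue_count A p < p" "h mod int p \<notin> (\<lambda>a. a mod int p) ` A"
  shows "ext_factor A p h
         = 1 - residue_count A p / ((real p - 1) * (real p - residue_count A p))"
proof -
  have "real p > 1" "real p - residue_count A p > 0"
    using prime_gt_1_nat[OF assms(1)] assms(2) by auto
  thus ?thesis using assms(3) by (simp add: ext_factor_def divide_simps) (simp add: algebra_simps)
qed

lemma ext_factor_le_1:
  assumes "prime p" "residue_count A p < p" "h mod int p \<notin> (\<lambda>a. a mod int p) ` A"
  shows "ext_factor A p h \<le> 1"
  unfolding ext_factor_eq_of_not_mem[OF assms]
  using prime_gt_1_nat[OF assms(1)] assms(2) by simp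

lemma ext_factor_le:
  assumes "prime p" "residue_count A p < p"
  shows "ext_factor A p h \<le> real p / (real p - 1)"
proof (cases "h mod int p \<in> (\<lambda>a. a mod int p) ` A")
  case False
  have "1 \<le> real p / (real p - 1)" using prime_gt_1_nat[OF assms(1)] by simp
  thus ?thesis using ext_factor_le_1[OF assms False] by linarith
qed (simp add: ext_factor_def)

lemma ext_factor_nonneg:
  assumes "prime p" "residue_count A p < p"
  shows "ext_factor A p h \<ge> 0"
proof -
  have "real p > 1" "real p - residue_count A p - 1 \<ge> 0"
    using prime_gt_1_nat[OF assms(1)] assms(2) by auto
  thus ?thesis by (auto simp: ext_factor_def)
qed

text \<open>Only a new class can push the factor below 1. Since \<open>p\<close> is at least twice
  the size of \<open>A\<close>, both \<open>p - 1\<close> and \<open>p - v\<close> are then at least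
  \<open>p / 2\<close>, which accounts for the 4.\<close>

lemma ext_factor_ge:
  assumes "finite A" "prime p" "2 * card A \<le> p" "residue_count A p < p"
  shows "ext_factor A p h \<ge> 1 - 4 * card A / (real p)\<^sup>2"
proof (cases "h mod int p \<in> (\<lambda>a. a mod int p) ` A")
  case True
  have "1 \<le> real p / (real p - 1)" using prime_gt_1_nat[OF assms(2)] by simp
  moreover have "4 * card A / (real p)\<^sup>2 \<ge> 0" by simp
  moreover have "ext_factor A p h = real p / (real p - 1)" using True by (simp add: ext_factor_def)
  ultimately show ?thesis by linarith
next
  case False
  define P v where "P = real p" and "v = real (residue_count A p)"
  have v: "v \<le> card A" using residue_count_le_card[OF assms(1)] by (simp add: v_def)
  have P: "P \<ge> 2" using prime_ge_2_nat[OF assms(2)] by (simp add: P_def)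
  have A: "2 * real (card A) \<le> P" using assms(3) unfolding P_def by (simp add: of_nat_mono flip: of_nat_mult)
  have "(P / 2) * (P / 2) \<le> (P - 1) * (P - v)"
    using P v A by (intro mult_mono) auto
  hence "v / ((P - 1) * (P - v)) \<le> card A / ((P / 2) * (P / 2))"
    using P v A by (intro frac_le) auto
  thus ?thesis
    unfolding ext_factor_eq_of_not_mem[OF assms(2,4) False] P_def[symmetric] v_def[symmetric]
    by (simp add: power2_eq_square field_simps)
qed

lemma ext_factor_cong_mod: "h mod int p = h' mod int p \<Longrightarrow> ext_factor A p h = ext_factor A p h'"
  by (simp add: ext_factor_def)

text \<open>The \<open>v\<close> occupied classes contribute \<open>v * P / (P - 1)\<close>, the
  other \<open>P - v\<close> classes \<open>P * (P - v - 1) / (P - 1)\<close>, and the total is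
  \<open>P\<close>. So the mean over a period is exactly 1, which is what makes the average of the
  singular series computable.\<close>

lemma sum_ext_factor_period:
  assumes "prime p" "residue_count A p < p"
  shows "(\<Sum>h<p. ext_factor A p (int h)) = p"
proof -
  define P v where "P = real p" and "v = residue_count A p"
  have P: "P > 1" "P - v > 0" using prime_gt_1_nat[OF assms(1)] assms(2) by (auto simp: P_def v_def)
  have p0: "p > 0" using prime_gt_0_nat[OF assms(1)] .
  define R where "R = (\<lambda>a. a mod int p) ` A"
  have R: "R \<subseteq> {0..<int p}" using p0 by (auto simp: R_def)
  have cR: "card R = v" by (simp add: R_def v_def residue_count_def)
  have "(\<Sum>h<p. ext_factor A p (int h)) = (\<Sum>h\<in>{0..<int p}. ext_factor A p h)"
    by (rule sum.reindex_bij_witness[of _ nat int]) auto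
  also have "\<dots> = (\<Sum>h\<in>{0..<int p} - R. ext_factor A p h) + (\<Sum>h\<in>R. ext_factor A p h)"
    by (rule sum.subset_diff[OF R]) simp
  also have "(\<Sum>h\<in>R. ext_factor A p h) = (\<Sum>h\<in>R. P / (P - 1))"
  proof (rule sum.cong[OF refl])
    fix h assume "h \<in> R"
    moreover from this R have "h mod int p = h" by auto
    ultimately show "ext_factor A p h = P / (P - 1)" by (simp add: ext_factor_def R_def P_def)
  qed
  also have "(\<Sum>h\<in>{0..<int p} - R. ext_factor A p h)
      = (\<Sum>h\<in>{0..<int p} - R. P * (P - v - 1) / ((P - 1) * (P - v)))"
  proof (rule sum.cong[OF refl])
    fix h assume h: "h \<in> {0..<int p} - R"
    hence "h mod int p = h" by auto
    with h show "ext_factor A p h = P * (P - v - 1) / ((P - 1) * (P - v))"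
      by (simp add: ext_factor_def R_def P_def v_def)
  qed
  also have "real (card ({0..<int p} - R)) = P - v"
    using R cR assms(2) finite_subset[OF R] by (simp add: card_Diff_subset v_def P_def of_nat_diff)
  hence "(\<Sum>h\<in>{0..<int p} - R. P * (P - v - 1) / ((P - 1) * (P - v)))
         = (P - v) * (P * (P - v - 1) / ((P - 1) * (P - v)))" by simp
  also have "\<dots> + (\<Sum>h\<in>R. P / (P - 1)) = P"
    using P cR by (simp add: divide_simps) (simp add: algebra_simps)
  finally show ?thesis by (simp add: P_def)
qed

section \<open>Means of products of periodic functions\<close>

text \<open>Chinese remainder theorem: taking residues modulo \<open>m\<close> and \<open>n\<close>
  is injective below \<open>m * n\<close>, hence by counting a bijection onto the pairs of residues,
  and the sum over pairs factors.\<close>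

lemma sum_mult_coprime_periods:
  fixes f g :: "nat \<Rightarrow> real"
  assumes "coprime m n" "m > 0" "n > 0"
    and "\<And>x. f (x mod m) = f x" "\<And>x. g (x mod n) = g x"
  shows "(\<Sum>x<m * n. f x * g x) = (\<Sum>x<m. f x) * (\<Sum>x<n. g x)"
proof -
  let ?c = "\<lambda>x. (x mod m, x mod n)"
  have inj: "inj_on ?c {..<m * n}"
  proof (rule inj_onI)
    fix x y assume *: "x \<in> {..<m * n}" "y \<in> {..<m * n}" "?c x = ?c y"
    hence "int m dvd int x - int y" "int n dvd int x - int y"
      by (simp_all add: mod_eq_dvd_iff[symmetric] flip: of_nat_mod)
    hence "int m * int n dvd int x - int y" using assms(1) by (intro divides_mult) auto
    hence "x mod (m * n) = y mod (m * n)"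
      by (simp add: mod_eq_dvd_iff[symmetric] flip: of_nat_mod of_nat_mult)
    with * show "x = y" by simp
  qed
  have img: "?c ` {..<m * n} = {..<m} \<times> {..<n}"
  proof (rule card_subset_eq)
    show "card (?c ` {..<m * n}) = card ({..<m} \<times> {..<n})" using card_image[OF inj] by simp
  qed (use assms in auto)
  have "(\<Sum>x<m. f x) * (\<Sum>x<n. g x) = (\<Sum>(a, b)\<in>{..<m} \<times> {..<n}. f a * g b)"
    by (simp add: sum_product sum.cartesian_product)
  also have "\<dots> = (\<Sum>x<m * n. f x * g x)"
    unfolding img[symmetric] sum.reindex[OF inj] by (simp add: assms)
  finally show ?thesis ..
qed

lemma sum_prod_prime_periods:
  fixes f :: "nat \<Rightarrow> nat \<Rightarrow> real"
  assumes "finite Q" "\<And>p. p \<in> Q \<Longrightarrow> prime p" "\<And>p x. p \<in> Q \<Longrightarrow> f p (x mod p) = f p x"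
  shows "(\<Sum>x<\<Prod>Q. \<Prod>p\<in>Q. f p x) = (\<Prod>p\<in>Q. \<Sum>x<p. f p x)"
  using assms
proof (induction Q rule: finite_induct)
  case (insert q Q)
  have pr: "prime q" using insert by simp
  have cop: "coprime q (\<Prod>Q)"
    by (rule prod_coprime_right) (use insert in \<open>auto intro!: primes_coprime\<close>)
  have per: "(\<Prod>p\<in>Q. f p (x mod \<Prod>Q)) = (\<Prod>p\<in>Q. f p x)" for x
  proof (rule prod.cong[OF refl])
    fix p assume p: "p \<in> Q"
    hence "p dvd \<Prod>Q" using insert.hyps(1) dvd_prodI[of Q p "\<lambda>p. p"] by simp
    hence "x mod \<Prod>Q mod p = x mod p" by (simp add: mod_mod_cancel)
    thus "f p (x mod \<Prod>Q) = f p x" using insert.prems(2)[of p] p by (metis insertCI)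
  qed
  have "\<Prod>Q > 0" using insert by (intro prod_pos) (auto intro: prime_gt_0_nat)
  hence "(\<Sum>x<q * \<Prod>Q. f q x * (\<Prod>p\<in>Q. f p x)) = (\<Sum>x<q. f q x) * (\<Sum>x<\<Prod>Q. \<Prod>p\<in>Q. f p x)"
    using cop prime_gt_0_nat[OF pr] per insert.prems by (intro sum_mult_coprime_periods) auto
  thus ?case using insert by simp
qed simp

text \<open>A full period has mean exactly 1, so removing it changes nothing. What is left has fewer
  than \<open>P\<close> terms, each within \<open>W + 1\<close> of 1.\<close>

lemma sum_periodic_approx:
  fixes f :: "nat \<Rightarrow> real"
  assumes "P > 0" "\<And>x. f (x + P) = f x" "(\<Sum>x<P. f x) = P" "\<And>x. 0 \<le> f x" "\<And>x. f x \<le> W"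
  shows "\<bar>(\<Sum>x<N. f x) - N\<bar> \<le> P * (W + 1)"
proof (induction N rule: less_induct)
  case (less N)
  have W: "W \<ge> 0" using assms(4)[of 0] assms(5)[of 0] by linarith
  show ?case
  proof (cases "N < P")
    case True
    have "\<bar>(\<Sum>x<N. f x) - N\<bar> = \<bar>\<Sum>x<N. f x - 1\<bar>" by (simp add: sum_subtractf)
    also have "\<dots> \<le> (\<Sum>x<N. \<bar>f x - 1\<bar>)" by (rule sum_abs)
    also have "\<dots> \<le> (\<Sum>x<N. W + 1)"
    proof (intro sum_mono)
      fix x show "\<bar>f x - 1\<bar> \<le> W + 1" using assms(4)[of x] assms(5)[of x] W by (simp add: abs_if)
    qed
    also have "\<dots> \<le> P * (W + 1)" using True W by (simp add: mult_right_mono)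
    finally show ?thesis .
  next
    case False
    then obtain M where M: "N = P + M" by (metis le_add_diff_inverse not_less)
    have "(\<Sum>x<N. f x) = (\<Sum>x<P. f x) + (\<Sum>x\<in>{P..<P + M}. f x)"
      unfolding M lessThan_atLeast0 by (rule sum.atLeastLessThan_concat[symmetric]) auto
    also have "(\<Sum>x\<in>{P..<P + M}. f x) = (\<Sum>x<M. f (x + P))"
      using sum.shift_bounds_nat_ivl[of f 0 P M] by (simp add: lessThan_atLeast0 add.commute)
    finally have "(\<Sum>x<N. f x) - N = (\<Sum>x<M. f x) - M" by (simp add: assms(2,3) M)
    thus ?thesis using less.IH[of M] M assms(1) by simp
  qed
qed

section \<open>The contribution of the large primes\<close>

text \<open>Each \<open>1 / n^2\<close> is at most \<open>1 / (n - 1) - 1 / n\<close>, and these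
  differences telescope.\<close>

lemma sum_inverse_squares_le:
  assumes "y > 0"
  shows "(\<Sum>n\<in>{y<..z}. 1 / (real n)\<^sup>2) \<le> 1 / real y"
proof -
  have "y \<le> z \<Longrightarrow> (\<Sum>n\<in>{y<..z}. 1 / (real n)\<^sup>2) \<le> 1 / real y - 1 / real z"
  proof (induction z rule: nat_induct_at_least[of y])
    case (Suc z)
    have z: "real z > 0" using Suc assms by simp
    have "1 / (real (Suc z))\<^sup>2 \<le> 1 / (real z * real (Suc z))"
      using z by (intro divide_left_mono) (auto simp: power2_eq_square)
    also have "\<dots> = 1 / real z - 1 / real (Suc z)" using z by (simp add: field_simps)
    finally have "1 / (real (Suc z))\<^sup>2 \<le> 1 / real z - 1 / real (Suc z)" .
    moreover have "{y<..Suc z} = insert (Suc z) {y<..z}" using Suc by auto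
    ultimately show ?case using Suc.IH by simp
  qed simp
  moreover have "1 / real y - 1 / real z \<le> 1 / real y" by simp
  ultimately show ?thesis by (cases "y \<le> z") (auto intro: order_trans)
qed

lemma sum_inverse_squares_subset_le:
  assumes "y > 0" "Q \<subseteq> {y<..z}"
  shows "(\<Sum>n\<in>Q. 1 / (real n)\<^sup>2) \<le> 1 / real y"
proof -
  have "(\<Sum>n\<in>Q. 1 / (real n)\<^sup>2) \<le> (\<Sum>n\<in>{y<..z}. 1 / (real n)\<^sup>2)"
    by (rule sum_mono2) (use assms in auto)
  also have "\<dots> \<le> 1 / real y" by (rule sum_inverse_squares_le) fact
  finally show ?thesis .
qed

text \<open>
  The divisibility condition on \<open>m\<close> is what makes the induction over \<open>Q\<close> go through; it is applied with \<open>r = 1\<close>.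
\<close>

lemma sum_prod_divisor_weights_le:
  fixes c :: real and N r :: nat and Q :: "nat set"
  assumes "finite Q" "\<And>p. p \<in> Q \<Longrightarrow> prime p" "c \<ge> 0" "r > 0" "\<And>p. p \<in> Q \<Longrightarrow> \<not> p dvd r"
  shows "(\<Sum>m | m \<in> {1..N} \<and> r dvd m. \<Prod>p\<in>Q. if p dvd m then 1 + c / p else 1)
         \<le> N / r * (\<Prod>p\<in>Q. 1 + c / (real p)\<^sup>2)"
  using assms
proof (induction Q arbitrary: r rule: finite_induct)
  case empty
  have "{m. m \<in> {1..N} \<and> r dvd m} \<subseteq> (\<lambda>i. r * i) ` {1..N div r}"
  proof
    fix m assume m: "m \<in> {m. m \<in> {1..N} \<and> r dvd m}"
    then obtain i where i: "m = r * i" by auto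
    with m have "i \<noteq> 0" by auto
    hence "i \<ge> 1" by simp
    moreover have "i \<le> N div r"
      using m i empty(3) by (metis (mono_tags) atLeastAtMost_iff div_le_mono mem_Collect_eq nonzero_mult_div_cancel_left not_less_zero)
    ultimately show "m \<in> (\<lambda>i. r * i) ` {1..N div r}" using i by auto
  qed
  hence "card {m. m \<in> {1..N} \<and> r dvd m} \<le> card ((\<lambda>i. r * i) ` {1..N div r})"
    by (intro card_mono) auto
  also have "\<dots> \<le> N div r" using card_image_le[of "{1..N div r}" "\<lambda>i. r * i"] by simp
  finally have "real (card {m. m \<in> {1..N} \<and> r dvd m}) \<le> real (N div r)" by simp
  also have "\<dots> \<le> real N / real r" by (rule of_nat_div_le_of_nat)
  finally show ?case by simp
next
  case (insert q Q)
  let ?w = "\<lambda>m. \<Prod>p\<in>Q. if p dvd m then 1 + c / real p else 1"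
  let ?X = "\<Prod>p\<in>Q. 1 + c / (real p)\<^sup>2"
  have q: "prime q" "\<not> q dvd r" using insert by auto
  have q0: "q > 0" using prime_gt_0_nat[OF q(1)] .
  have dvd: "r dvd m \<and> q dvd m \<longleftrightarrow> r * q dvd m" for m
    using q prime_imp_coprime[of q r] by (metis coprime_commute divides_mult dvd_mult_left dvd_mult_right)
  have nd: "\<not> p dvd r * q" if "p \<in> Q" for p
    using insert that q by (metis insertCI prime_dvd_mult_iff primes_dvd_imp_eq)
  \<comment> \<open>The weight at \<open>q\<close> is 1 plus \<open>c / q\<close> on the multiples
    of \<open>q\<close>. Multiples of \<open>r\<close> divisible by \<open>q\<close> are the
    multiples of \<open>r * q\<close>, so the induction hypothesis applies with \<open>r\<close> and
    with \<open>r * q\<close>; the second use carries a further \<open>1 / q\<close>, which produces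
    the factor \<open>1 + c / q^2\<close>.\<close>
  have "(\<Sum>m | m \<in> {1..N} \<and> r dvd m. \<Prod>p\<in>insert q Q. if p dvd m then 1 + c / p else 1)
      = (\<Sum>m | m \<in> {1..N} \<and> r dvd m. ?w m + (if q dvd m then c / q * ?w m else 0))"
    using insert by (intro sum.cong) (auto simp: algebra_simps)
  also have "\<dots> = (\<Sum>m | m \<in> {1..N} \<and> r dvd m. ?w m)
      + (\<Sum>m | m \<in> {1..N} \<and> r dvd m. if q dvd m then c / q * ?w m else 0)"
    by (simp add: sum.distrib)
  also have "(\<Sum>m | m \<in> {1..N} \<and> r dvd m. if q dvd m then c / q * ?w m else 0)
      = (\<Sum>m | m \<in> {1..N} \<and> r * q dvd m. c / q * ?w m)"
    by (subst sum.inter_filter[symmetric]) (auto intro!: sum.cong simp: dvd[symmetric])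
  also have "\<dots> = c / q * (\<Sum>m | m \<in> {1..N} \<and> r * q dvd m. ?w m)"
    by (simp add: sum_distrib_left)
  also have "(\<Sum>m | m \<in> {1..N} \<and> r dvd m. ?w m) + \<dots> \<le> N / r * ?X + c / q * (N / (r * q) * ?X)"
  proof (intro add_mono mult_left_mono)
    show "(\<Sum>m | m \<in> {1..N} \<and> r dvd m. ?w m) \<le> N / r * ?X"
      using insert.IH[of r] insert.prems by auto
    show "(\<Sum>m | m \<in> {1..N} \<and> r * q dvd m. ?w m) \<le> N / (r * q) * ?X"
      using insert.IH[of "r * q"] insert.prems nd q0 by auto
  qed (use insert.prems in auto)
  also have "\<dots> = N / r * (\<Prod>p\<in>insert q Q. 1 + c / (real p)\<^sup>2)"
    using insert q0 by (simp add: field_simps power2_eq_square)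
  finally show ?case .
qed

text \<open>By convexity \<open>(1 + t)^K\<close> lies below its chord
  \<open>1 + (2^K - 1) * t\<close> on the unit interval. The induction is run on the chord itself
  and weakened only at the end.\<close>

lemma one_plus_power_le:
  fixes t :: real
  assumes "0 \<le> t" "t \<le> 1"
  shows "(1 + t) ^ K \<le> 1 + 2 ^ K * t"
proof -
  have "(1 + t) ^ K \<le> 1 + (2 ^ K - 1) * t"
  proof (induction K)
    case (Suc K)
    have "(1 + t) ^ Suc K \<le> (1 + t) * (1 + (2 ^ K - 1) * t)"
      using Suc assms by (simp add: mult_left_mono)
    also have "\<dots> = 1 + t + (2 ^ K - 1) * t + (2 ^ K - 1) * (t * t)" by (simp add: algebra_simps)
    also have "\<dots> \<le> 1 + t + (2 ^ K - 1) * t + (2 ^ K - 1) * t"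
      using assms mult_left_le[of t t] by (intro add_left_mono mult_left_mono) auto
    also have "\<dots> = 1 + (2 ^ Suc K - 1) * t" by (simp add: algebra_simps)
    finally show ?case .
  qed simp
  also have "\<dots> \<le> 1 + 2 ^ K * t" using assms by (simp add: algebra_simps)
  finally show ?thesis .
qed

text \<open>On average over \<open>m\<close>, the product of \<open>p / (p - 1)\<close> over the
  prime divisors of \<open>m\<close> beyond \<open>y\<close> exceeds 1 by only
  \<open>O(1/y)\<close>, even after raising it to the power \<open>K\<close>. The power of a single
  factor is at most \<open>1 + c / p\<close> with \<open>c = 2^(K+1)\<close>, the average of the
  resulting weights is at most the product of the \<open>1 + c / p^2\<close>, and that is at most
  \<open>exp (c / y)\<close>.\<close>

lemma sum_divisor_product_power_le:
  fixes N K y z :: nat and Q :: "nat set"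
  assumes "y > 0" "Q \<subseteq> {y<..z}" "\<And>p. p \<in> Q \<Longrightarrow> prime p"
  shows "(\<Sum>m\<in>{1..N}. (\<Prod>p\<in>Q. if p dvd m then real p / (real p - 1) else 1) ^ K - 1)
         \<le> N * (exp (2 ^ (K + 1) / y) - 1)"
proof -
  define c :: real where "c = 2 ^ (K + 1)"
  have fin: "finite Q" using assms(2) finite_subset by blast
  have le: "(real p / (real p - 1)) ^ K \<le> 1 + c / p" if "p \<in> Q" for p
  proof -
    have p: "real p \<ge> 2" using prime_ge_2_nat[OF assms(3)[OF that]] by simp
    have eq: "real p / (real p - 1) = 1 + 1 / (real p - 1)" using p by (simp add: field_simps)
    have "(1 + 1 / (real p - 1)) ^ K \<le> 1 + 2 ^ K * (1 / (real p - 1))"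
      using p by (intro one_plus_power_le) (auto simp: field_simps)
    moreover have "1 / (real p - 1) \<le> 2 / p" using p by (simp add: field_simps)
    hence "2 ^ K * (1 / (real p - 1)) \<le> 2 ^ K * (2 / p)" by (rule mult_left_mono) simp
    ultimately have "(real p / (real p - 1)) ^ K \<le> 1 + 2 ^ K * (2 / p)"
      unfolding eq by linarith
    thus ?thesis by (simp add: c_def mult_ac)
  qed
  have "(\<Sum>m\<in>{1..N}. (\<Prod>p\<in>Q. if p dvd m then real p / (real p - 1) else 1) ^ K)
        \<le> (\<Sum>m\<in>{1..N}. \<Prod>p\<in>Q. if p dvd m then 1 + c / p else 1)"
  proof (rule sum_mono)
    fix m
    have "(\<Prod>p\<in>Q. if p dvd m then real p / (real p - 1) else 1) ^ K
          = (\<Prod>p\<in>Q. (if p dvd m then real p / (real p - 1) else 1) ^ K)"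
      by (rule prod_power_distrib)
    also have "\<dots> \<le> (\<Prod>p\<in>Q. if p dvd m then 1 + c / p else 1)"
    proof (rule prod_mono)
      fix p assume p: "p \<in> Q"
      have "real p \<ge> 2" using prime_ge_2_nat[OF assms(3)[OF p]] by simp
      thus "0 \<le> (if p dvd m then real p / (real p - 1) else 1) ^ K \<and>
            (if p dvd m then real p / (real p - 1) else 1) ^ K \<le> (if p dvd m then 1 + c / p else 1)"
        using le[OF p] by simp
    qed
    finally show "(\<Prod>p\<in>Q. if p dvd m then real p / (real p - 1) else 1) ^ K
          \<le> (\<Prod>p\<in>Q. if p dvd m then 1 + c / p else 1)" .
  qed
  also have "\<dots> = (\<Sum>m | m \<in> {1..N} \<and> 1 dvd m. \<Prod>p\<in>Q. if p dvd m then 1 + c / p else 1)"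
    by (rule sum.cong) auto
  also have "\<dots> \<le> N / (1::nat) * (\<Prod>p\<in>Q. 1 + c / (real p)\<^sup>2)"
    using assms fin by (intro sum_prod_divisor_weights_le) (auto simp: c_def)
  also have "\<dots> \<le> N * exp (c / y)"
  proof -
    have "(\<Prod>p\<in>Q. 1 + c / (real p)\<^sup>2) \<le> exp (\<Sum>p\<in>Q. c / (real p)\<^sup>2)"
      by (rule prod_le_exp_sum) (simp add: c_def)
    also have "(\<Sum>p\<in>Q. c / (real p)\<^sup>2) = c * (\<Sum>p\<in>Q. 1 / (real p)\<^sup>2)"
      by (simp add: sum_distrib_left)
    also have "\<dots> \<le> c * (1 / y)"
      using sum_inverse_squares_subset_le[OF assms(1,2)] by (intro mult_left_mono) (auto simp: c_def)
    finally show ?thesis by (simp add: mult_left_mono)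
  qed
  finally show ?thesis by (simp add: sum_subtractf c_def algebra_simps)
qed

text \<open>The product is at most the \<open>card A\<close>-th power of its largest factor, and
  that power appears as one of the nonnegative terms on the right. This reduces a product over all
  \<open>a\<close> in \<open>A\<close> to averages over a single shift.\<close>

lemma prod_minus_1_le:
  fixes x :: "'a \<Rightarrow> real"
  assumes "finite A" "\<And>a. a \<in> A \<Longrightarrow> x a \<ge> 1"
  shows "(\<Prod>a\<in>A. x a) - 1 \<le> (\<Sum>a\<in>A. x a ^ card A - 1)"
proof (cases "A = {}")
  case False
  obtain b where b: "b \<in> A" "x b = Max (x ` A)"
    using Max_in[of "x ` A"] assms(1) False by (metis (mono_tags, lifting) finite_imageI image_iff image_is_empty)
  have "(\<Prod>a\<in>A. x a) \<le> (\<Prod>a\<in>A. x b)"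
  proof (rule prod_mono)
    fix a assume "a \<in> A"
    thus "0 \<le> x a \<and> x a \<le> x b" using assms(2)[of a] assms(1) b by simp
  qed
  hence "(\<Prod>a\<in>A. x a) - 1 \<le> x b ^ card A - 1" by simp
  also have "\<dots> \<le> (\<Sum>a\<in>A. x a ^ card A - 1)"
    using assms b(1) by (intro member_le_sum) (auto simp: one_le_power)
  finally show ?thesis .
qed simp

section \<open>An elementary bound for the product of Mertens\<close>

text \<open>The reciprocal of the product of \<open>1 - 1/p\<close> that Mertens's theorem
  evaluates. It bounds the truncated quotient of singular series pointwise.\<close>

definition mertens_prod :: "nat \<Rightarrow> real" where
  "mertens_prod y = (\<Prod>p\<in>primes_upto y. real p / (real p - 1))"

text \<open>From \<open>2n + 1\<close> to \<open>2n + 3\<close> the product grows at most by the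
  factor for \<open>2n + 3\<close>, whether or not that number is prime. This factor
  \<open>(2n + 3) / (2n + 2)\<close> is at most \<open>sqrt ((2n + 3) / (2n + 1))\<close>, because
  \<open>(2n + 1) * (2n + 3)\<close> is at most \<open>(2n + 2)^2\<close>. The true order is
  logarithmic, but any bound of smaller order than the argument serves against an error of order
  \<open>1/y\<close>.\<close>

lemma mertens_prod_le_sqrt:
  assumes "n \<ge> 1"
  shows "mertens_prod (2 * n + 1) \<le> 2 * sqrt (2 * n + 1)"
  using assms unfolding mertens_prod_def
proof (induction n rule: nat_induct_at_least)
  case base
  have "primes_upto 3 = {2, 3}"
  proof -
    have "prime (3::nat)" "prime (2::nat)" by simp_all
    moreover have "p = 2 \<or> p = 3" if "p \<le> 3" "prime p" for p :: nat
      using that prime_ge_2_nat[of p] by linarith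
    ultimately show ?thesis by (auto simp: primes_upto_def)
  qed
  moreover have "3 \<le> 2 * sqrt 3" by (rule power2_le_imp_le) (auto simp: power_mult_distrib)
  ultimately show ?case by (simp add: numeral_3_eq_3[symmetric])
next
  case (Suc n)
  let ?W = "\<lambda>n. \<Prod>p\<in>primes_upto n. real p / (real p - 1)"
  have sub: "primes_upto (2 * n + 3) \<subseteq> insert (2 * n + 3) (primes_upto (2 * n + 1))"
  proof
    fix p assume p: "p \<in> primes_upto (2 * n + 3)"
    hence "odd p" if "p = 2 * n + 2" using prime_odd_nat[of p] that Suc.hyps by (auto simp: primes_upto_def)
    hence "p \<noteq> 2 * n + 2" by auto
    with p show "p \<in> insert (2 * n + 3) (primes_upto (2 * n + 1))" by (auto simp: primes_upto_def)
  qed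
  have ge1: "real p / (real p - 1) \<ge> 1" if "p \<ge> 2" for p using that by simp
  have "?W (2 * n + 3) \<le> (\<Prod>p\<in>insert (2 * n + 3) (primes_upto (2 * n + 1)). real p / (real p - 1))"
  proof (rule prod_mono2[OF _ sub])
    fix p assume "p \<in> insert (2 * n + 3) (primes_upto (2 * n + 1)) - primes_upto (2 * n + 3)"
    hence "p = 2 * n + 3" by (auto simp: primes_upto_def)
    thus "1 \<le> real p / (real p - 1)" by (intro ge1) simp
  next
    fix p assume "p \<in> primes_upto (2 * n + 3)"
    hence "p \<ge> 2" by (auto simp: primes_upto_def dest: prime_ge_2_nat)
    thus "0 \<le> real p / (real p - 1)" by simp
  qed simp
  also have "\<dots> = (2 * n + 3) / (2 * n + 2) * ?W (2 * n + 1)"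
    by (subst prod.insert) (auto simp: primes_upto_def)
  also have "\<dots> \<le> (2 * n + 3) / (2 * n + 2) * (2 * sqrt (2 * n + 1))"
    using Suc.IH by (intro mult_left_mono) auto
  also have "\<dots> \<le> 2 * sqrt (2 * n + 3)"
  proof -
    have "(2 * real n + 3) * sqrt (2 * n + 1) \<le> (2 * n + 2) * sqrt (2 * n + 3)"
    proof (rule power2_le_imp_le)
      show "((2 * real n + 3) * sqrt (2 * n + 1))\<^sup>2 \<le> ((2 * n + 2) * sqrt (2 * n + 3))\<^sup>2"
        by (simp add: power_mult_distrib) (simp add: power2_eq_square algebra_simps)
    qed simp
    thus ?thesis by (simp add: divide_simps algebra_simps)
  qed
  finally have "?W (2 * n + 3) \<le> 2 * sqrt (2 * n + 3)" .
  moreover have "2 * Suc n + 1 = 2 * n + 3" "2 * real (Suc n) + 1 = 2 * n + 3" by simp_all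
  ultimately show ?case by (simp only:)
qed

text \<open>Each distance from \<open>a\<close> occurs at most twice, once on either side.\<close>

lemma sum_abs_diff_le:
  fixes f :: "nat \<Rightarrow> real"
  assumes "\<And>m. f m \<ge> 0" "a \<in> {1..int N}"
  shows "(\<Sum>h\<in>{1..int N} - {a}. f (nat \<bar>h - a\<bar>)) \<le> 2 * (\<Sum>m\<in>{1..N}. f m)"
proof -
  have part: "(\<Sum>h\<in>B. f (nat \<bar>h - a\<bar>)) \<le> (\<Sum>m\<in>{1..N}. f m)"
    if "inj_on (\<lambda>h. nat \<bar>h - a\<bar>) B" "B \<subseteq> {1..int N} - {a}" for B
  proof -
    have "(\<Sum>h\<in>B. f (nat \<bar>h - a\<bar>)) = (\<Sum>m\<in>(\<lambda>h. nat \<bar>h - a\<bar>) ` B. f m)"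
      by (simp add: sum.reindex[OF that(1)])
    also have "\<dots> \<le> (\<Sum>m\<in>{1..N}. f m)"
      using that(2) assms by (intro sum_mono2) force+
    finally show ?thesis .
  qed
  have "{1..int N} - {a} = {1..<a} \<union> {a<..int N}" using assms(2) by auto
  hence "(\<Sum>h\<in>{1..int N} - {a}. f (nat \<bar>h - a\<bar>))
         = (\<Sum>h\<in>{1..<a}. f (nat \<bar>h - a\<bar>)) + (\<Sum>h\<in>{a<..int N}. f (nat \<bar>h - a\<bar>))"
    by (simp add: sum.union_disjoint disjoint_iff)
  also have "\<dots> \<le> (\<Sum>m\<in>{1..N}. f m) + (\<Sum>m\<in>{1..N}. f m)"
    using assms(2) by (intro add_mono part) (auto simp: inj_on_def)
  finally show ?thesis by simp
qed

section \<open>The mean of the quotient of singular series\<close>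

text \<open>The quotient truncated at \<open>y\<close> is periodic modulo the product of the primes
  up to \<open>y\<close>, takes values between 0 and \<open>mertens_prod y\<close>, and has mean
  exactly 1 by the Chinese remainder theorem.\<close>

lemma sum_prod_ext_factor_approx:
  assumes "finite A" "admissible A"
  shows "\<bar>(\<Sum>h\<in>{1..int N}. \<Prod>p\<in>primes_upto y. ext_factor A p h) - N\<bar>
         \<le> (\<Prod>(primes_upto y) + 1) * (mertens_prod y + 1)"
proof -
  define W where "W = mertens_prod y"
  let ?P = "\<Prod>(primes_upto y)"
  define F where "F = (\<lambda>n::nat. \<Prod>p\<in>primes_upto y. ext_factor A p (int n))"
  have pr: "prime p" "residue_count A p < p" if "p \<in> primes_upto y" for p
    using that assms(2) by (auto simp: primes_upto_def admissible_def)
  have F0: "F n \<ge> 0" for n unfolding F_def by (intro prod_nonneg) (auto intro: ext_factor_nonneg pr)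
  have FW: "F n \<le> W" for n
    unfolding F_def W_def mertens_prod_def by (intro prod_mono) (auto intro: ext_factor_nonneg ext_factor_le pr)
  have "?P > 0" by (intro prod_pos) (auto intro: prime_gt_0_nat pr)
  moreover have "F (n + ?P) = F n" for n
    unfolding F_def
  proof (intro prod.cong refl ext_factor_cong_mod)
    fix p assume "p \<in> primes_upto y"
    hence "p dvd ?P" using dvd_prodI[of "primes_upto y" p "\<lambda>p. p"] by simp
    hence "int p dvd int ?P" by (simp only: int_dvd_int_iff)
    then obtain k where "int ?P = int p * k" by (rule dvdE)
    thus "int (n + ?P) mod int p = int n mod int p" by simp
  qed
  moreover have "(\<Sum>n<?P. F n) = ?P"
  proof -
    have "(\<Sum>n<?P. F n) = (\<Prod>p\<in>primes_upto y. \<Sum>n<p. ext_factor A p (int n))"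
      unfolding F_def
      by (rule sum_prod_prime_periods) (auto intro: pr ext_factor_cong_mod simp: zmod_int)
    also have "\<dots> = (\<Prod>p\<in>primes_upto y. real p)"
      by (intro prod.cong refl sum_ext_factor_period pr)
    finally show ?thesis by simp
  qed
  ultimately have *: "\<bar>(\<Sum>n<N + 1. F n) - (N + 1 :: nat)\<bar> \<le> ?P * (W + 1)"
    using F0 FW by (intro sum_periodic_approx) auto
  \<comment> \<open>The periodic estimate starts at 0 and the desired sum at 1. Removing
    \<open>F 0\<close> and adjusting the count costs at most \<open>W + 1\<close>, hence the added 1
    in the first factor of the bound.\<close>
  have "(\<Sum>n<N + 1. F n) = F 0 + (\<Sum>n\<in>{1..N}. F n)"
    using sum.lessThan_Suc_shift[of F N] by (simp add: sum.atLeast1_atMost_eq)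
  also have "(\<Sum>n\<in>{1..N}. F n) = (\<Sum>h\<in>{1..int N}. \<Prod>p\<in>primes_upto y. ext_factor A p h)"
    unfolding F_def by (rule sum.reindex_bij_witness[of _ nat int]) auto
  finally show ?thesis using * F0[of 0] FW[of 0] by (simp add: W_def[symmetric] algebra_simps abs_le_iff)
qed

text \<open>The factor at \<open>p\<close> exceeds 1 only if \<open>p\<close> divides
  \<open>h - a\<close> for some \<open>a\<close> in \<open>A\<close>, and is then at most
  \<open>p / (p - 1)\<close>. Multiplying over every \<open>a\<close> only enlarges the bound and
  separates the elements of \<open>A\<close> from one another.\<close>

lemma prod_ext_factor_le:
  assumes "finite A" "admissible A" "finite Q" "\<And>p. p \<in> Q \<Longrightarrow> prime p"
  shows "(\<Prod>p\<in>Q. ext_factor A p h)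
         \<le> (\<Prod>a\<in>A. \<Prod>p\<in>Q. if p dvd nat \<bar>h - a\<bar> then real p / (real p - 1) else 1)"
proof -
  have "(\<Prod>p\<in>Q. ext_factor A p h)
        \<le> (\<Prod>p\<in>Q. \<Prod>a\<in>A. if p dvd nat \<bar>h - a\<bar> then real p / (real p - 1) else 1)"
  proof (rule prod_mono)
    fix p assume p: "p \<in> Q"
    have pr: "prime p" "residue_count A p < p"
      using assms p by (auto simp: admissible_def)
    have dvd: "p dvd nat \<bar>h - a\<bar> \<longleftrightarrow> h mod int p = a mod int p" for a
      by (metis dvd_abs_iff int_dvd_int_iff int_nat_eq abs_ge_zero mod_eq_dvd_iff)
    have ge1: "1 \<le> real p / (real p - 1)" using prime_gt_1_nat[OF pr(1)] by simp
    have "ext_factor A p h \<le> (\<Prod>a\<in>A. if p dvd nat \<bar>h - a\<bar> then real p / (real p - 1) else 1)"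
    proof (cases "h mod int p \<in> (\<lambda>a. a mod int p) ` A")
      case True
      then obtain a where a: "a \<in> A" "h mod int p = a mod int p" by auto
      have "real p / (real p - 1) = (\<Prod>b\<in>{a}. if p dvd nat \<bar>h - b\<bar> then real p / (real p - 1) else 1)"
        using a dvd by simp
      also have "\<dots> \<le> (\<Prod>a\<in>A. if p dvd nat \<bar>h - a\<bar> then real p / (real p - 1) else 1)"
      proof (rule prod_mono2)
        show "1 \<le> (if p dvd nat \<bar>h - b\<bar> then real p / (real p - 1) else 1)" for b
          using ge1 by simp
        show "0 \<le> (if p dvd nat \<bar>h - b\<bar> then real p / (real p - 1) else 1)" for b
          using ge1 by simp
      qed (use a assms in auto)
      finally show ?thesis using ext_factor_le[OF pr, of h] by linarith
    next
      case False
      have "1 \<le> (\<Prod>a\<in>A. if p dvd nat \<bar>h - a\<bar> then real p / (real p - 1) else 1)"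
        using ge1 by (intro prod_ge_1) auto
      thus ?thesis using ext_factor_le_1[OF pr False] by linarith
    qed
    thus "0 \<le> ext_factor A p h \<and> ext_factor A p h
          \<le> (\<Prod>a\<in>A. if p dvd nat \<bar>h - a\<bar> then real p / (real p - 1) else 1)"
      using ext_factor_nonneg[OF pr] by blast
  qed
  thus ?thesis by (subst prod.swap)
qed

lemma mertens_prod_ge_1: "mertens_prod y \<ge> 1"
  unfolding mertens_prod_def
proof (rule prod_ge_1)
  fix p assume "p \<in> primes_upto y"
  thus "1 \<le> real p / (real p - 1)" using prime_gt_1_nat[of p] by (simp add: primes_upto_def)
qed

text \<open>The quotient is split as \<open>F h * T h\<close>, with the primes up to
  \<open>y\<close> in \<open>F\<close> and those between \<open>y\<close> and \<open>z\<close> in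
  \<open>T\<close>. The mean of \<open>F\<close> is known; \<open>T\<close> is bounded below
  pointwise and above on average. Neither bound involves \<open>z\<close>, so both survive the
  passage to the limit.\<close>

lemma sum_prod_ext_factor_bounds:
  fixes N K y z :: nat
  assumes "A \<subseteq> {1..int N}" "admissible A" "card A = K" "y > 0" "4 * K \<le> y" "y \<le> z"
  defines "C \<equiv> real (\<Prod>(primes_upto y) + 1) * (mertens_prod y + 1)"
  defines "S \<equiv> \<Sum>h\<in>{1..int N} - A. \<Prod>p\<in>primes_upto z. ext_factor A p h"
  shows "S \<ge> real N * (1 - 4 * real K / real y) - C - real K * mertens_prod y"
    and "S \<le> real N * (1 + 2 * real K * mertens_prod y * (exp (2 ^ (K + 1) / real y) - 1)) + C"
proof -
  define W where "W = mertens_prod y"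
  define Q where "Q = primes_upto z - primes_upto y"
  define F where "F = (\<lambda>h. \<Prod>p\<in>primes_upto y. ext_factor A p h)"
  define T where "T = (\<lambda>h. \<Prod>p\<in>Q. ext_factor A p h)"
  have fin: "finite A" using assms(1) finite_subset by blast
  have Q: "finite Q" "Q \<subseteq> {y<..z}" "\<And>p. p \<in> Q \<Longrightarrow> prime p" by (auto simp: Q_def primes_upto_def)
  have pr: "prime p" "residue_count A p < p" if "p \<in> primes_upto n" for p n
    using that assms(2) by (auto simp: primes_upto_def admissible_def)
  have prQ: "prime p" "residue_count A p < p" if "p \<in> Q" for p
    using that pr by (auto simp: Q_def)
  have W1: "W \<ge> 1" by (simp add: W_def mertens_prod_ge_1)
  have split: "(\<Prod>p\<in>primes_upto z. ext_factor A p h) = F h * T h" for h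
  proof -
    have "primes_upto y \<subseteq> primes_upto z" using assms(6) by (auto simp: primes_upto_def)
    thus ?thesis unfolding F_def T_def Q_def by (subst prod.subset_diff) (auto simp: mult.commute)
  qed
  have F0: "F h \<ge> 0" for h unfolding F_def by (intro prod_nonneg) (auto intro: ext_factor_nonneg pr)
  have FW: "F h \<le> W" for h
    unfolding F_def W_def mertens_prod_def
    by (intro prod_mono) (auto intro: ext_factor_nonneg ext_factor_le pr)
  have avg: "\<bar>(\<Sum>h\<in>{1..int N}. F h) - N\<bar> \<le> C"
    unfolding F_def C_def by (rule sum_prod_ext_factor_approx) (use fin assms in auto)
  have S: "S = (\<Sum>h\<in>{1..int N} - A. F h * T h)" by (simp add: S_def split)

  \<comment> \<open>The product of the \<open>1 - 4K/p^2\<close> is at least 1 minus their sum, by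
    the Weierstrass inequality. The condition that \<open>y\<close> is at least \<open>4 * K\<close>
    keeps each subtracted term within the unit interval.\<close>
  have T_ge: "T h \<ge> 1 - 4 * real K / real y" for h
  proof -
    have "1 - 4 * real K / real y \<le> 1 - (\<Sum>p\<in>Q. 4 * real K / (real p)\<^sup>2)"
    proof -
      have "(\<Sum>p\<in>Q. 4 * real K / (real p)\<^sup>2) = 4 * K * (\<Sum>p\<in>Q. 1 / (real p)\<^sup>2)"
        by (simp add: sum_distrib_left)
      also have "\<dots> \<le> 4 * K * (1 / y)"
        by (intro mult_left_mono sum_inverse_squares_subset_le[OF assms(4) Q(2)]) auto
      finally show ?thesis by simp
    qed
    also have small: "4 * real K / (real p)\<^sup>2 \<in> {0..1}" if "p \<in> Q" for p
    proof -
      have p: "4 * K \<le> p" "p > 0" using that Q(2) assms(5) by auto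
      hence "real (4 * K) \<le> real p" by (simp only: of_nat_le_iff)
      also have "\<dots> \<le> (real p)\<^sup>2" using p by (intro self_le_power) auto
      finally show ?thesis using p by simp
    qed
    hence "1 - (\<Sum>p\<in>Q. 4 * real K / (real p)\<^sup>2) \<le> (\<Prod>p\<in>Q. 1 - 4 * real K / (real p)\<^sup>2)"
      by (rule Weierstrass_prod_ineq)
    also have "\<dots> \<le> T h"
      unfolding T_def
    proof (rule prod_mono)
      fix p assume p: "p \<in> Q"
      have "2 * card A \<le> p" using p Q(2) assms(3,5) by auto
      thus "0 \<le> 1 - 4 * real K / (real p)\<^sup>2 \<and> 1 - 4 * real K / (real p)\<^sup>2 \<le> ext_factor A p h"
        using small[OF p] ext_factor_ge[OF fin prQ(1)[OF p] _ prQ(2)[OF p]] assms(3) by auto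
    qed
    finally show ?thesis .
  qed
  have "real (4 * K) \<le> real y" using assms(5) by (simp only: of_nat_le_iff)
  hence q: "0 \<le> 1 - 4 * real K / real y" "1 - 4 * real K / real y \<le> 1" using assms(4) by (auto simp: field_simps)
  have FA: "(\<Sum>h\<in>{1..int N}. F h) = (\<Sum>h\<in>{1..int N} - A. F h) + (\<Sum>h\<in>A. F h)"
    by (rule sum.subset_diff) (use assms(1) in auto)
  have FA0: "(\<Sum>h\<in>A. F h) \<ge> 0" by (intro sum_nonneg F0)
  have FAW: "(\<Sum>h\<in>A. F h) \<le> K * W" using sum_mono[of A F "\<lambda>_. W"] FW assms(3) by simp
  define u where "u = 1 - 4 * real K / real y"
  have "S \<ge> (\<Sum>h\<in>{1..int N} - A. F h * u)"
    unfolding S u_def by (intro sum_mono mult_left_mono T_ge F0)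
  also have "(\<Sum>h\<in>{1..int N} - A. F h * u) = (\<Sum>h\<in>{1..int N} - A. F h) * u"
    by (simp add: sum_distrib_right)
  finally have 1: "S \<ge> (\<Sum>h\<in>{1..int N} - A. F h) * u" .
  have "(N - C - K * W) * u \<le> (\<Sum>h\<in>{1..int N} - A. F h) * u"
    using FA FAW avg q by (intro mult_right_mono) (auto simp: u_def)
  moreover have "(C + K * W) * u \<le> C + K * W"
    using q W1 by (intro mult_left_le) (auto simp: u_def C_def W_def intro!: add_nonneg_nonneg mult_nonneg_nonneg prod_nonneg)
  ultimately show "S \<ge> real N * (1 - 4 * real K / real y) - C - real K * mertens_prod y"
    using 1 unfolding u_def[symmetric] W_def[symmetric] by (simp add: algebra_simps)

  define g where "g = (\<lambda>m. \<Prod>p\<in>Q. if p dvd m then real p / (real p - 1) else 1)"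
  have g1: "g m \<ge> 1" for m
    unfolding g_def
  proof (rule prod_ge_1)
    fix p assume "p \<in> Q"
    thus "1 \<le> (if p dvd m then real p / (real p - 1) else 1)"
      using prime_gt_1_nat[OF Q(3)] by simp
  qed
  have T_le: "T h \<le> 1 + (\<Sum>a\<in>A. g (nat \<bar>h - a\<bar>) ^ K - 1)" for h
  proof -
    have "T h \<le> (\<Prod>a\<in>A. g (nat \<bar>h - a\<bar>))"
      unfolding T_def g_def by (rule prod_ext_factor_le) (use fin assms Q in auto)
    also have "\<dots> \<le> 1 + (\<Sum>a\<in>A. g (nat \<bar>h - a\<bar>) ^ K - 1)"
      using prod_minus_1_le[of A "\<lambda>a. g (nat \<bar>h - a\<bar>)"] fin g1 assms(3) by simp
    finally show ?thesis .
  qed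
  have nn: "0 \<le> g m ^ K - 1" for m using g1 by (simp add: one_le_power)
  \<comment> \<open>The pointwise bound \<open>W\<close> is spent only on the excess of
    \<open>T\<close> over 1; the main term retains \<open>F\<close>, whose mean is exact.\<close>
  have "F h * T h \<le> F h + W * (\<Sum>a\<in>A. g (nat \<bar>h - a\<bar>) ^ K - 1)" for h
  proof -
    have "F h * T h \<le> F h * (1 + (\<Sum>a\<in>A. g (nat \<bar>h - a\<bar>) ^ K - 1))"
      by (intro mult_left_mono T_le F0)
    also have "\<dots> \<le> F h + W * (\<Sum>a\<in>A. g (nat \<bar>h - a\<bar>) ^ K - 1)"
      using mult_right_mono[OF FW sum_nonneg[of A "\<lambda>a. g (nat \<bar>h - a\<bar>) ^ K - 1"]] nn
      by (simp add: algebra_simps)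
    finally show ?thesis .
  qed
  hence "S \<le> (\<Sum>h\<in>{1..int N} - A. F h + W * (\<Sum>a\<in>A. g (nat \<bar>h - a\<bar>) ^ K - 1))"
    unfolding S by (intro sum_mono)
  also have "\<dots> = (\<Sum>h\<in>{1..int N} - A. F h)
      + W * (\<Sum>a\<in>A. \<Sum>h\<in>{1..int N} - A. g (nat \<bar>h - a\<bar>) ^ K - 1)"
    by (simp only: sum.distrib sum_distrib_left[symmetric]) (subst sum.swap, rule refl)
  also have "\<dots> \<le> (N + C) + W * (\<Sum>a\<in>A. 2 * (N * (exp (2 ^ (K + 1) / y) - 1)))"
  proof (intro add_mono mult_left_mono sum_mono)
    show "(\<Sum>h\<in>{1..int N} - A. F h) \<le> N + C" using FA FA0 avg by linarith
    fix a assume a: "a \<in> A"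
    have "(\<Sum>h\<in>{1..int N} - A. g (nat \<bar>h - a\<bar>) ^ K - 1)
          \<le> (\<Sum>h\<in>{1..int N} - {a}. g (nat \<bar>h - a\<bar>) ^ K - 1)"
      by (rule sum_mono2) (use a nn in auto)
    also have "\<dots> \<le> 2 * (\<Sum>m\<in>{1..N}. g m ^ K - 1)"
      by (rule sum_abs_diff_le) (use nn a assms(1) in auto)
    also have "(\<Sum>m\<in>{1..N}. g m ^ K - 1) \<le> N * (exp (2 ^ (K + 1) / y) - 1)"
      unfolding g_def by (rule sum_divisor_product_power_le) (use Q assms in auto)
    finally show "(\<Sum>h\<in>{1..int N} - A. g (nat \<bar>h - a\<bar>) ^ K - 1)
        \<le> 2 * (N * (exp (2 ^ (K + 1) / y) - 1))" by simp
  qed (use W1 in auto)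
  also have "\<dots> = real N * (1 + 2 * real K * mertens_prod y * (exp (2 ^ (K + 1) / real y) - 1)) + C"
    using assms(3) by (simp add: W_def algebra_simps)
  finally show "S \<le> \<dots>" .
qed

text \<open>\<open>mertens_prod y\<close> is of order at most the square root of \<open>y\<close>,
  and \<open>exp (c / y) - 1\<close> of order \<open>1/y\<close>, so the product tends to 0. The
  choice \<open>y = 2 * n + 1\<close> fits the odd arguments at which the square root bound is
  available.\<close>

lemma truncation_error_small:
  assumes "\<epsilon> > 0"
  obtains y where "y > 0" "4 * K \<le> y" "4 * real K / real y < \<epsilon>"
    "2 * real K * mertens_prod y * (exp (2 ^ (K + 1) / y) - 1) < \<epsilon>"
proof -
  define c :: real where "c = 2 ^ (K + 1)"
  define s where "s = (\<lambda>n::nat. real (2 * n + 1))"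
  have s: "filterlim s at_top sequentially"
    unfolding s_def
    by (rule filterlim_compose[OF filterlim_real_sequentially], rule filterlim_subseq)
       (auto simp: strict_mono_def)
  have "(\<lambda>n. 4 * real K / s n) \<longlonglongrightarrow> 0"
    by (rule real_tendsto_divide_at_top[OF tendsto_const s])
  hence e1: "\<forall>\<^sub>F n in sequentially. 4 * real K / s n < \<epsilon>" using assms by (rule order_tendstoD)
  have "filterlim (\<lambda>n. sqrt (s n)) at_top sequentially"
    by (rule filterlim_compose[OF sqrt_at_top s])
  hence "(\<lambda>n. 8 * real K * c / sqrt (s n)) \<longlonglongrightarrow> 0"
    by (rule real_tendsto_divide_at_top[OF tendsto_const])
  hence e2: "\<forall>\<^sub>F n in sequentially. 8 * real K * c / sqrt (s n) < \<epsilon>" using assms by (rule order_tendstoD)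
  have e3: "\<forall>\<^sub>F n in sequentially. s n \<ge> c" using s by (auto simp: filterlim_at_top)
  have "\<forall>\<^sub>F n in sequentially. n \<ge> max 1 (4 * K)" by (rule eventually_ge_at_top)
  with e1 e2 e3 have "\<forall>\<^sub>F n in sequentially. n \<ge> max 1 (4 * K) \<and> s n \<ge> c \<and>
    4 * real K / s n < \<epsilon> \<and> 8 * real K * c / sqrt (s n) < \<epsilon>" by eventually_elim auto
  then obtain n where n: "n \<ge> 1" "n \<ge> 4 * K" "s n \<ge> c" "4 * real K / s n < \<epsilon>" "8 * real K * c / sqrt (s n) < \<epsilon>"
    by (auto simp: eventually_sequentially)
  have s0: "s n > 0" by (simp add: s_def)
  have ex: "exp (c / s n) - 1 \<le> 2 * (c / s n)"
  proof -
    have "c / s n \<ge> 0" "c / s n \<le> 1" using n(3) s0 by (auto simp: c_def)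
    thus ?thesis using exp_bound_lemma[of "c / s n"] exp_bound[of "c / s n"]
      mult_left_le[of "c / s n" "c / s n"] by (simp add: power2_eq_square)
  qed
  have "2 * real K * mertens_prod (2 * n + 1) * (exp (c / s n) - 1)
        \<le> 2 * real K * (2 * sqrt (s n)) * (2 * (c / s n))"
    using ex mertens_prod_le_sqrt[OF n(1)] mertens_prod_ge_1[of "2 * n + 1"] s0
    by (intro mult_mono) (auto simp: s_def c_def algebra_simps)
  also have "\<dots> = 8 * real K * c / sqrt (s n)"
    using s0 real_sqrt_mult_self[of "s n"] by (simp add: field_simps)
  also have "\<dots> < \<epsilon>" by fact
  finally show ?thesis using n by (intro that[of "2 * n + 1"]) (auto simp: s_def c_def)
qed

text \<open>First \<open>y\<close> is fixed in terms of \<open>\<epsilon>\<close> and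
  \<open>K\<close>, which turns the periodic error into a constant, negligible for large
  \<open>N\<close> uniformly in \<open>A\<close>. For each \<open>z\<close> beyond \<open>y\<close>
  the common factor \<open>partial_series A z\<close> comes out of the sum, which makes the error
  relative; then \<open>z\<close> tends to infinity. For inadmissible \<open>A\<close> every series
  involved is 0.\<close>

theorem singular_series_extension_average:
  assumes "\<epsilon> > 0"
  obtains D where "\<And>N A. N \<ge> D \<Longrightarrow> A \<subseteq> {1..int N} \<Longrightarrow> card A = K \<Longrightarrow>
    \<bar>(\<Sum>h\<in>{1..int N} - A. singular_series (insert h A)) - N * singular_series A\<bar>
    \<le> \<epsilon> * N * singular_series A"
proof -
  obtain y where y: "y > 0" "4 * K \<le> y" "4 * real K / real y < \<epsilon> / 2"
    "2 * real K * mertens_prod y * (exp (2 ^ (K + 1) / y) - 1) < \<epsilon> / 2"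
    using truncation_error_small[of "\<epsilon> / 2" K] assms by auto
  define C where "C = real (\<Prod>(primes_upto y) + 1) * (mertens_prod y + 1)"
  define C' where "C' = C + K * mertens_prod y"
  have CC': "C \<le> C'" using mertens_prod_ge_1[of y] by (simp add: C'_def)
  \<comment> \<open>From this point on the constant error \<open>C'\<close> is at most half of
    \<open>\<epsilon> * N\<close>.\<close>
  define D where "D = nat \<lceil>C' / (\<epsilon> / 2)\<rceil>"
  have main: "\<bar>(\<Sum>h\<in>{1..int N} - A. singular_series (insert h A)) - N * singular_series A\<bar>
    \<le> \<epsilon> * N * singular_series A"
    if N: "N \<ge> D" and A: "A \<subseteq> {1..int N}" "card A = K" for N A
  proof -
    have fin: "finite A" using A(1) finite_subset by blast
    show ?thesis
    proof (cases "admissible A")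
      case False
      have "\<not> admissible (insert h A)" for h
      proof -
        from False obtain p where p: "prime p" "residue_count A p \<ge> p" by (auto simp: admissible_def not_less)
        hence "residue_count (insert h A) p \<ge> p" by (simp add: residue_count_insert[OF fin])
        thus ?thesis using p(1) by (auto simp: admissible_def not_less)
      qed
      thus ?thesis using False fin by (simp add: singular_series_eq_0)
    next
      case True
      have "C' / (\<epsilon> / 2) \<le> real D" unfolding D_def by linarith
      also have "\<dots> \<le> N" using N by simp
      finally have CN: "C' \<le> \<epsilon> / 2 * N" using assms by (simp add: field_simps)
      define R where "R = (\<lambda>z. \<Sum>h\<in>{1..int N} - A. \<Prod>p\<in>primes_upto z. ext_factor A p h)"
      have R: "\<bar>R z - N\<bar> \<le> \<epsilon> * N" if z: "y \<le> z" for z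
      proof -
        have "R z \<ge> real N * (1 - 4 * real K / real y) - C'"
          using sum_prod_ext_factor_bounds(1)[OF A(1) True A(2) y(1,2) z] by (simp add: R_def C'_def C_def)
        also have "real N * (1 - 4 * real K / real y) = N - N * (4 * real K / real y)"
          by (simp add: right_diff_distrib)
        finally have lo: "N - N * (4 * real K / real y) - C' \<le> R z" .
        have "R z \<le> real N * (1 + 2 * real K * mertens_prod y * (exp (2 ^ (K + 1) / real y) - 1)) + C"
          using sum_prod_ext_factor_bounds(2)[OF A(1) True A(2) y(1,2) z] by (simp add: R_def C_def)
        also have "real N * (1 + 2 * real K * mertens_prod y * (exp (2 ^ (K + 1) / real y) - 1))
            = N + N * (2 * real K * mertens_prod y * (exp (2 ^ (K + 1) / real y) - 1))"
          by (simp only: distrib_left mult_1_right)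
        finally have up: "R z \<le> \<dots> + C" .
        have "N * (4 * real K / real y) \<le> N * (\<epsilon> / 2)" using y(3) by (intro mult_left_mono) auto
        moreover have "N * (2 * real K * mertens_prod y * (exp (2 ^ (K + 1) / real y) - 1)) \<le> N * (\<epsilon> / 2)"
          using y(4) by (intro mult_left_mono) auto
        moreover have "\<epsilon> * N = N * (\<epsilon> / 2) + \<epsilon> / 2 * N" by simp
        ultimately show ?thesis using lo up CN CC' unfolding abs_le_iff by linarith
      qed
      have ins: "partial_series (insert h A) z = partial_series A z * (\<Prod>p\<in>primes_upto z. ext_factor A p h)"
        if "h \<notin> A" for h z
        unfolding partial_series_def prod.distrib[symmetric]
        using True by (intro prod.cong refl local_factor_insert fin that) (auto simp: primes_upto_def admissible_def)
      have sumR: "(\<Sum>h\<in>{1..int N} - A. partial_series (insert h A) z) = partial_series A z * R z" for z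
        by (simp add: R_def ins sum_distrib_left)
      have lim: "(\<lambda>z. \<bar>(\<Sum>h\<in>{1..int N} - A. partial_series (insert h A) z) - N * partial_series A z\<bar>)
        \<longlonglongrightarrow> \<bar>(\<Sum>h\<in>{1..int N} - A. singular_series (insert h A)) - N * singular_series A\<bar>"
        by (intro tendsto_intros partial_series_tendsto finite.insertI fin)
      have lim': "(\<lambda>z. \<epsilon> * N * partial_series A z) \<longlonglongrightarrow> \<epsilon> * N * singular_series A"
        by (intro tendsto_intros partial_series_tendsto fin)
      show ?thesis
      proof (rule tendsto_le[OF _ lim' lim])
        show "\<forall>\<^sub>F z in sequentially.
          \<bar>(\<Sum>h\<in>{1..int N} - A. partial_series (insert h A) z) - N * partial_series A z\<bar>
          \<le> \<epsilon> * N * partial_series A z"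
          using eventually_ge_at_top[of y]
        proof eventually_elim
          case (elim z)
          have "partial_series A z * R z - N * partial_series A z = partial_series A z * (R z - N)"
            by (simp add: algebra_simps)
          hence "\<bar>partial_series A z * R z - N * partial_series A z\<bar> = partial_series A z * \<bar>R z - N\<bar>"
            using partial_series_nonneg[of A z] by (simp add: abs_mult)
          also have "\<dots> \<le> partial_series A z * (\<epsilon> * N)"
            by (intro mult_left_mono R elim partial_series_nonneg)
          finally show ?case unfolding sumR by (simp add: algebra_simps)
        qed
      qed simp
    qed
  qed
  show ?thesis by (rule that[of D]) (rule main)
qed

section \<open>Averages over sets with prescribed extreme elements\<close>

text \<open>The index \<open>k\<close> counts the elements strictly between the two ends 1 and
  \<open>N\<close>, so that it matches the index of the binomial moments below.\<close>

definition span_sets :: "nat \<Rightarrow> nat \<Rightarrow> int set set" where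
  "span_sets N k = {H. H \<subseteq> {1..int N} \<and> {1, int N} \<subseteq> H \<and> card H = k + 2}"

lemma finite_span_sets [simp, intro]: "finite (span_sets N k)"
  by (rule finite_subset[of _ "Pow {1..int N}"]) (auto simp: span_sets_def)

lemma span_setsD:
  assumes "H \<in> span_sets N k"
  shows "finite H" "card H = k + 2" "H \<subseteq> {1..int N}" "1 \<in> H" "int N \<in> H"
  using assms finite_subset[of H "{1..int N}"] by (auto simp: span_sets_def)

text \<open>Double counting of pairs of a set and a chosen inner element: a set with
  \<open>k + 1\<close> inner elements arises from \<open>k + 1\<close> smaller sets, one for each
  element that may have been adjoined.\<close>

lemma sum_span_sets_insert:
  fixes f :: "int set \<Rightarrow> real"
  assumes "N \<ge> 2"
  shows "(\<Sum>A\<in>span_sets N k. \<Sum>h\<in>{1..int N} - A. f (insert h A))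
         = real (k + 1) * (\<Sum>B\<in>span_sets N (k + 1). f B)"
proof -
  have "(\<Sum>A\<in>span_sets N k. \<Sum>h\<in>{1..int N} - A. f (insert h A))
        = (\<Sum>(A, h)\<in>(SIGMA A:span_sets N k. {1..int N} - A). f (insert h A))"
    by (rule sum.Sigma) auto
  also have "\<dots> = (\<Sum>(B, h)\<in>(SIGMA B:span_sets N (k + 1). B - {1, int N}). f B)"
  proof (rule sum.reindex_bij_witness[of _ "\<lambda>(B, h). (B - {h}, h)" "\<lambda>(A, h). (insert h A, h)"])
    fix x assume x: "x \<in> (SIGMA A:span_sets N k. {1..int N} - A)"
    obtain A h where [simp]: "x = (A, h)" by (cases x)
    have A: "A \<in> span_sets N k" "h \<in> {1..int N}" "h \<notin> A" using x by auto
    note * = span_setsD[OF A(1)]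
    show "(case case x of (A, h) \<Rightarrow> (insert h A, h) of (B, h) \<Rightarrow> (B - {h}, h)) = x" using A by simp
    show "(case x of (A, h) \<Rightarrow> (insert h A, h)) \<in> (SIGMA B:span_sets N (k + 1). B - {1, int N})"
      using A * by (auto simp: span_sets_def)
  next
    fix x assume x: "x \<in> (SIGMA B:span_sets N (k + 1). B - {1, int N})"
    obtain B h where [simp]: "x = (B, h)" by (cases x)
    have B: "B \<in> span_sets N (k + 1)" "h \<in> B" "h \<noteq> 1" "h \<noteq> int N" using x by auto
    note * = span_setsD[OF B(1)]
    show "(case case x of (B, h) \<Rightarrow> (B - {h}, h) of (A, h) \<Rightarrow> (insert h A, h)) = x"
      using B by (auto simp: insert_absorb)
    show "(case x of (B, h) \<Rightarrow> (B - {h}, h)) \<in> (SIGMA A:span_sets N k. {1..int N} - A)"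
      using B * by (auto simp: span_sets_def)
  qed (auto simp: insert_absorb)
  also have "\<dots> = (\<Sum>B\<in>span_sets N (k + 1). \<Sum>h\<in>B - {1, int N}. f B)"
    by (rule sum.Sigma[symmetric]) (auto dest: span_setsD)
  also have "\<dots> = (\<Sum>B\<in>span_sets N (k + 1). real (k + 1) * f B)"
  proof (rule sum.cong[OF refl])
    fix B assume B: "B \<in> span_sets N (k + 1)"
    have "card (B - {1, int N}) = card B - card {1, int N}"
      using span_setsD[OF B] by (intro card_Diff_subset) auto
    also have "\<dots> = k + 1" using span_setsD[OF B] assms by simp
    finally show "(\<Sum>h\<in>B - {1, int N}. f B) = real (k + 1) * f B" by simp
  qed
  finally show ?thesis by (simp only: sum_distrib_left)
qed

lemma span_sets_0: "N \<ge> 2 \<Longrightarrow> span_sets N 0 = {{1, int N}}"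
proof -
  assume N: "N \<ge> 2"
  have "H = {1, int N}" if H: "H \<in> span_sets N 0" for H
    using span_setsD[OF H] N by (intro card_subset_eq[symmetric]) auto
  moreover have "{1, int N} \<in> span_sets N 0" using N by (simp add: span_sets_def)
  ultimately show ?thesis by blast
qed

text \<open>The double counting with \<open>f\<close> constantly 1 bounds \<open>k + 1\<close> times
  the next cardinality by \<open>N\<close> times the present one.\<close>

lemma card_span_sets_le:
  assumes "N \<ge> 2"
  shows "real (card (span_sets N k)) \<le> real N ^ k"
proof (induction k)
  case (Suc k)
  have "real (card (span_sets N (Suc k))) \<le> (k + 1) * real (card (span_sets N (Suc k)))"
    by (simp add: algebra_simps)
  also have "\<dots> = (\<Sum>A\<in>span_sets N k. \<Sum>h\<in>{1..int N} - A. 1)"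
    using sum_span_sets_insert[OF assms, of "\<lambda>_. 1" k] by simp
  also have "\<dots> \<le> (\<Sum>A\<in>span_sets N k. real N)"
  proof (rule sum_mono)
    fix A show "(\<Sum>h\<in>{1..int N} - A. 1) \<le> real N"
      using card_mono[of "{1..int N}" "{1..int N} - A"] by auto
  qed
  also have "\<dots> = N * real (card (span_sets N k))" by simp
  also have "\<dots> \<le> N * real N ^ k" using Suc.IH by (intro mult_left_mono) auto
  finally show ?case by simp
qed (simp add: span_sets_0[OF assms])

text \<open>Induction on the number of inner elements. Double counting expresses
  \<open>k + 1\<close> times the next sum through one-element extensions, and the extension average
  makes this about \<open>N\<close> times the present sum; dividing by \<open>k + 1\<close> builds
  up the factorial.\<close>

theorem singular_series_average:
  fixes \<epsilon> :: real
  assumes "\<epsilon> > 0"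
  shows "\<exists>D::nat. \<forall>N\<ge>D.
    \<bar>(\<Sum>H\<in>span_sets N k. singular_series H) - real N ^ k / fact k * singular_series {1, int N}\<bar>
    \<le> \<epsilon> * real N ^ k * singular_series {1, int N}"
  using assms
proof (induction k arbitrary: \<epsilon>)
  case 0
  show ?case
  proof (intro exI[of _ 2] allI impI)
    fix N :: nat assume "N \<ge> 2"
    thus "\<bar>(\<Sum>H\<in>span_sets N 0. singular_series H) - real N ^ 0 / fact 0 * singular_series {1, int N}\<bar>
          \<le> \<epsilon> * real N ^ 0 * singular_series {1, int N}"
      using 0 by (simp add: span_sets_0 singular_series_nonneg)
  qed
next
  case (Suc k)
  \<comment> \<open>With \<open>M = N^k * singular_series {1, N}\<close>, the bound 1 on
    \<open>\<delta>\<close> gives \<open>E k\<close> at most \<open>2 * M\<close>. The extension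
    error is then at most \<open>2 * \<delta> * N * M\<close>, and the induction hypothesis adds
    \<open>\<delta> * N * M\<close>, which explains the third.\<close>
  define \<delta> where "\<delta> = min 1 (\<epsilon> / 3)"
  have \<delta>: "\<delta> > 0" "\<delta> \<le> 1" "3 * \<delta> \<le> \<epsilon>" using Suc.prems by (auto simp: \<delta>_def)
  obtain D1 where D1: "\<And>N. N \<ge> D1 \<Longrightarrow>
    \<bar>(\<Sum>H\<in>span_sets N k. singular_series H) - real N ^ k / fact k * singular_series {1, int N}\<bar>
    \<le> \<delta> * real N ^ k * singular_series {1, int N}"
    using Suc.IH[OF \<delta>(1)] by blast
  obtain D2 where D2: "\<And>N A. N \<ge> D2 \<Longrightarrow> A \<subseteq> {1..int N} \<Longrightarrow> card A = k + 2 \<Longrightarrow>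
    \<bar>(\<Sum>h\<in>{1..int N} - A. singular_series (insert h A)) - N * singular_series A\<bar>
    \<le> \<delta> * N * singular_series A"
    using singular_series_extension_average[OF \<delta>(1), of "k + 2"] by blast
  show ?case
  proof (intro exI[of _ "max 2 (max D1 D2)"] allI impI)
    fix N assume N: "max 2 (max D1 D2) \<le> N"
    define S where "S = singular_series {1, int N}"
    define E where "E = (\<lambda>j. \<Sum>H\<in>span_sets N j. singular_series H)"
    define M where "M = real N ^ k * S"
    have S0: "S \<ge> 0" by (simp add: S_def singular_series_nonneg)
    have M0: "M \<ge> 0" using S0 by (simp add: M_def)
    have E1: "\<bar>E k - M / fact k\<bar> \<le> \<delta> * M"
      using D1[of N] N by (simp add: E_def S_def M_def mult.assoc)
    have "(k + 1) * E (k + 1) - N * E k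
          = (\<Sum>A\<in>span_sets N k. (\<Sum>h\<in>{1..int N} - A. singular_series (insert h A)) - N * singular_series A)"
      using sum_span_sets_insert[of N singular_series k] N
      by (simp add: E_def sum_subtractf sum_distrib_left)
    also have "\<bar>\<dots>\<bar> \<le> (\<Sum>A\<in>span_sets N k.
        \<bar>(\<Sum>h\<in>{1..int N} - A. singular_series (insert h A)) - N * singular_series A\<bar>)"
      by (rule sum_abs)
    also have "\<dots> \<le> (\<Sum>A\<in>span_sets N k. \<delta> * N * singular_series A)"
      using N by (intro sum_mono D2) (auto dest: span_setsD)
    also have "\<dots> = \<delta> * N * E k" by (simp add: E_def sum_distrib_left)
    finally have E2: "\<bar>(k + 1) * E (k + 1) - N * E k\<bar> \<le> \<delta> * N * E k" .
    have "M / fact k \<le> M" using M0 by (simp add: divide_le_eq fact_ge_1 mult_le_cancel_left1)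
    with E1 \<delta>(2) M0 have "E k \<le> 2 * M" using mult_right_mono[of \<delta> 1 M] by linarith
    hence "\<delta> * N * E k \<le> \<delta> * N * (2 * M)" using \<delta>(1) by (intro mult_left_mono) auto
    moreover have "\<bar>N * E k - N * (M / fact k)\<bar> \<le> N * (\<delta> * M)"
    proof -
      have "N * E k - N * (M / fact k) = N * (E k - M / fact k)" by (simp only: right_diff_distrib)
      thus ?thesis using mult_left_mono[OF E1, of "real N"] by (simp add: abs_mult)
    qed
    ultimately have "\<bar>(k + 1) * E (k + 1) - N * (M / fact k)\<bar> \<le> 3 * \<delta> * (N * M)"
      using E2 by (simp add: algebra_simps)
    also have "\<dots> \<le> \<epsilon> * (N * M)" using \<delta>(3) M0 by (intro mult_right_mono) auto
    also have "\<dots> \<le> (k + 1) * (\<epsilon> * (N * M))"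
      using M0 Suc.prems by (simp add: mult_le_cancel_right1 algebra_simps)
    also have "(k + 1) * E (k + 1) - N * (M / fact k)
               = (k + 1) * (E (k + 1) - N * M / fact (k + 1))"
      by (simp add: field_simps del: of_nat_Suc)
    finally have "\<bar>E (k + 1) - N * M / fact (k + 1)\<bar> \<le> \<epsilon> * (N * M)"
      unfolding abs_mult by simp
    thus "\<bar>(\<Sum>H\<in>span_sets N (Suc k). singular_series H) - real N ^ Suc k / fact (Suc k) * singular_series {1, int N}\<bar>
        \<le> \<epsilon> * real N ^ Suc k * singular_series {1, int N}"
      by (simp add: E_def M_def S_def mult.assoc)
  qed
qed

section \<open>The singular series of a pair\<close>

lemma residue_count_pair:
  assumes "d > 0"
  shows "residue_count {1, int (d + 1)} p = (if p dvd d then 1 else 2)"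
proof -
  have "int (d + 1) mod int p = 1 mod int p \<longleftrightarrow> p dvd d"
    by (simp add: mod_eq_dvd_iff)
  thus ?thesis by (auto simp: residue_count_def)
qed

definition twin_factor :: "nat \<Rightarrow> real" where
  "twin_factor p = (if p > 2 then 1 - 1 / (real p - 1)\<^sup>2 else 1)"

lemma twin_prime_const_conv: "twin_prime_const = prodinf (\<lambda>p. if prime p then twin_factor p else 1)"
  unfolding twin_prime_const_def twin_factor_def by (intro prodinf_cong) auto

lemma convergent_prod_twin_factor: "convergent_prod (\<lambda>p. if prime p then twin_factor p else 1)"
proof -
  have le: "norm ((if prime p then twin_factor p else 1) - 1) \<le> 4 * inverse (real p ^ 2)" for p
  proof (cases "p > 2")
    case True
    have "(real p / 2)\<^sup>2 \<le> (real p - 1)\<^sup>2" using True by (intro power_mono) auto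
    hence "1 / (real p - 1)\<^sup>2 \<le> 1 / (real p / 2)\<^sup>2" using True by (intro divide_left_mono) auto
    also have "\<dots> = 4 * inverse (real p ^ 2)" by (simp add: power2_eq_square field_simps)
    finally show ?thesis using True by (simp add: twin_factor_def)
  qed (simp add: twin_factor_def)
  have "summable (\<lambda>p. 4 * inverse (real p ^ 2))"
    by (intro summable_mult inverse_power_summable) auto
  hence "summable (\<lambda>p. norm ((if prime p then twin_factor p else 1) - 1))"
  proof (rule summable_comparison_test'[where N = 0])
    fix p show "norm (norm ((if prime p then twin_factor p else 1) - 1)) \<le> 4 * inverse (real p ^ 2)"
      using le[of p] by (simp only: real_norm_def abs_abs)
  qed
  thus ?thesis
    by (intro abs_convergent_prod_imp_convergent_prod) (simp add: abs_convergent_prod_conv_summable)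
qed

lemma twin_factor_pos: "twin_factor p > 0"
proof (cases "p > 2")
  case True
  hence "(real p - 1)\<^sup>2 > 1" by (intro one_less_power) auto
  thus ?thesis by (simp add: twin_factor_def)
qed (simp add: twin_factor_def)

lemma prod_twin_factor_tendsto: "(\<lambda>n. \<Prod>p\<in>primes_upto n. twin_factor p) \<longlonglongrightarrow> twin_prime_const"
  using convergent_prod_LIMSEQ[OF convergent_prod_twin_factor]
  by (simp add: prod_if_prime_eq twin_prime_const_conv)

lemma twin_prime_const_pos: "twin_prime_const > 0"
  unfolding twin_prime_const_conv
  by (rule less_0_prodinf[OF convergent_prod_twin_factor]) (simp add: twin_factor_pos)

text \<open>Every factor \<open>(p - 1) / (p - 2)\<close> is at least 1. The bound is uniform in
  \<open>d\<close>, which keeps error terms negligible although the main term varies with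
  \<open>d\<close>.\<close>

lemma pair_singular_series_ge:
  assumes "even d"
  shows "pair_singular_series d \<ge> 2 * twin_prime_const"
proof -
  have "1 \<le> (\<Prod>p | prime p \<and> p dvd d \<and> p > 2. (real p - 1) / (real p - 2))"
    by (rule prod_ge_1) auto
  thus ?thesis
    using assms twin_prime_const_pos by (simp add: pair_singular_series_def)
qed

text \<open>The local factor of the pair is \<open>twin_factor\<close> times a correction
  \<open>r p\<close>, equal to 2 at 2, to \<open>(p - 1) / (p - 2)\<close> at odd primes dividing
  \<open>d\<close>, and to 1 elsewhere. Past \<open>max 2 d\<close> all corrections are collected,
  and the partial products are a fixed multiple of those of \<open>twin_prime_const\<close>.\<close>

lemma singular_series_pair:
  assumes "d > 0" "even d"
  shows "singular_series {1, int (d + 1)} = pair_singular_series d"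
proof -
  define r where "r = (\<lambda>p::nat. if p = 2 then 2 else if p dvd d then (real p - 1) / (real p - 2) else 1)"
  define c where "c = 2 * (\<Prod>p | prime p \<and> p dvd d \<and> p > 2. (real p - 1) / (real p - 2))"
  have lf: "local_factor {1, int (d + 1)} p = r p * twin_factor p" if p: "prime p" for p
  proof (cases "p = 2")
    case True
    thus ?thesis using assms
      unfolding local_factor_def residue_count_pair[OF assms(1)]
      by (simp add: r_def twin_factor_def power_int_minus field_simps)
  next
    case False
    hence p3: "real p > 2" using prime_ge_2_nat[OF p] by linarith
    have card: "card {1, int (d + 1)} = 2" using assms by simp
    have "inverse ((1 - 1 / real p)\<^sup>2) * (1 - 1 / real p)
          = (real p - 1) / (real p - 2) * (1 - 1 / (real p - 1)\<^sup>2)"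
    proof -
      have "inverse ((1 - 1 / real p)\<^sup>2) * (1 - 1 / real p) = real p / (real p - 1)"
      proof -
        have "1 - 1 / real p = (real p - 1) / real p" using p3 by (simp add: field_simps)
        thus ?thesis using p3 by (simp add: power2_eq_square)
      qed
      moreover have "1 - 1 / (real p - 1)\<^sup>2 = real p * (real p - 2) / (real p - 1)\<^sup>2"
        using p3 by (simp add: divide_simps) (simp add: power2_eq_square algebra_simps)
      ultimately show ?thesis using p3 by (simp add: power2_eq_square)
    qed
    moreover have "inverse ((1 - 1 / real p)\<^sup>2) * (1 - 2 / real p) = 1 - 1 / (real p - 1)\<^sup>2"
    proof -
      have "1 - 1 / real p = (real p - 1) / real p" "1 - 2 / real p = (real p - 2) / real p"
        using p3 by (simp_all add: field_simps)
      hence "inverse ((1 - 1 / real p)\<^sup>2) * (1 - 2 / real p) = real p * (real p - 2) / (real p - 1)\<^sup>2"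
        using p3 by (simp add: power2_eq_square)
      moreover have "1 - 1 / (real p - 1)\<^sup>2 = real p * (real p - 2) / (real p - 1)\<^sup>2"
        using p3 by (simp add: divide_simps) (simp add: power2_eq_square algebra_simps)
      ultimately show ?thesis by simp
    qed
    ultimately show ?thesis using False p3 prime_ge_2_nat[OF p]
      unfolding local_factor_def card power_int_uminus_of_nat residue_count_pair[OF assms(1)]
      by (auto simp: r_def twin_factor_def)
  qed
  have "\<forall>\<^sub>F n in sequentially. partial_series {1, int (d + 1)} n = c * (\<Prod>p\<in>primes_upto n. twin_factor p)"
    using eventually_ge_at_top[of "max 2 d"]
  proof eventually_elim
    case (elim n)
    let ?D = "{p. prime p \<and> p dvd d \<and> p > 2}"
    have "partial_series {1, int (d + 1)} n = (\<Prod>p\<in>primes_upto n. r p * twin_factor p)"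
      unfolding partial_series_def by (intro prod.cong refl lf) (auto simp: primes_upto_def)
    also have "\<dots> = (\<Prod>p\<in>primes_upto n. r p) * (\<Prod>p\<in>primes_upto n. twin_factor p)"
      by (rule prod.distrib)
    also have "(\<Prod>p\<in>primes_upto n. r p) = (\<Prod>p\<in>insert 2 ?D. r p)"
    proof (rule prod.mono_neutral_right)
      show "insert 2 ?D \<subseteq> primes_upto n"
      proof
        fix p assume "p \<in> insert 2 ?D"
        hence "prime p \<and> (p = 2 \<or> p \<le> d)" using assms(1) by (auto dest: dvd_imp_le)
        thus "p \<in> primes_upto n" using elim by (auto simp: primes_upto_def)
      qed
      show "\<forall>p\<in>primes_upto n - insert 2 ?D. r p = 1"
      proof
        fix p assume p: "p \<in> primes_upto n - insert 2 ?D"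
        hence "p \<noteq> 2" "prime p" by (auto simp: primes_upto_def)
        with prime_ge_2_nat[of p] have "p > 2" by linarith
        with p show "r p = 1" by (auto simp: r_def primes_upto_def)
      qed
    qed simp
    also have "\<dots> = r 2 * (\<Prod>p\<in>?D. r p)"
    proof (rule prod.insert)
      have "?D \<subseteq> {..d}" using assms(1) by (auto dest: dvd_imp_le)
      thus "finite ?D" by (rule finite_subset) simp
    qed simp
    also have "\<dots> = c" unfolding c_def by (auto simp: r_def intro!: prod.cong)
    finally show ?case .
  qed
  moreover have "(\<lambda>n. c * (\<Prod>p\<in>primes_upto n. twin_factor p)) \<longlonglongrightarrow> c * twin_prime_const"
    by (intro tendsto_intros prod_twin_factor_tendsto)
  ultimately have "partial_series {1, int (d + 1)} \<longlonglongrightarrow> c * twin_prime_const"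
    by (simp add: tendsto_cong)
  with partial_series_tendsto[of "{1, int (d + 1)}"]
  have "singular_series {1, int (d + 1)} = c * twin_prime_const" by (intro LIMSEQ_unique) auto
  thus ?thesis using assms by (simp add: pair_singular_series_def c_def)
qed

section \<open>Bonferroni inequalities for prime gaps\<close>

text \<open>
  Positions are shifted by one, so that the tuples lie in \<open>[1, d + 1]\<close>: the position \<open>n\<close> stands for the
  pair of primes \<open>n + 1\<close> and \<open>n + 1 + d\<close>.
\<close>

definition pair_positions :: "real \<Rightarrow> nat \<Rightarrow> nat set" where
  "pair_positions x d = {n. n \<ge> 1 \<and> real n \<le> x \<and> prime (n + 1) \<and> prime (n + 1 + d)}"

text \<open>The offsets from 2 to \<open>d\<close> are exactly those strictly between the two ends 1
  and \<open>d + 1\<close>.\<close>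

definition inner_primes :: "nat \<Rightarrow> nat \<Rightarrow> int set" where
  "inner_primes d n = {h\<in>{2..int d}. prime (int n + h)}"

definition tuple_sum :: "real \<Rightarrow> nat \<Rightarrow> nat \<Rightarrow> real" where
  "tuple_sum x d k = (\<Sum>H\<in>span_sets (d + 1) k. real (tuple_count x H))"

lemma finite_nat_le_real [simp]: "finite {n::nat. n \<ge> 1 \<and> real n \<le> x}"
  by (rule finite_subset[of _ "{..nat \<lfloor>x\<rfloor>}"]) (auto simp: le_nat_floor)

lemma finite_pair_positions [simp]: "finite (pair_positions x d)"
  by (rule finite_subset[OF _ finite_nat_le_real[of x]]) (auto simp: pair_positions_def)

lemma finite_inner_primes [simp]: "finite (inner_primes d n)"
  by (rule finite_subset[of _ "{2..int d}"]) (auto simp: inner_primes_def)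

lemma real_card_filter:
  "finite I \<Longrightarrow> real (card {n\<in>I. P n}) = (\<Sum>n\<in>I. if P n then 1 else 0)"
  by (simp add: sum.inter_filter[symmetric])

lemma prime_int_plus: "prime (int n + int m) \<longleftrightarrow> prime (n + m)"
  by (metis of_nat_add prime_int_nat_transfer prime_nat_int_transfer)

text \<open>Deleting the two ends is a bijection onto the \<open>k\<close>-element sets of inner
  primes, provided both ends give primes; otherwise no set qualifies.\<close>

lemma card_span_sets_all_prime:
  assumes "d > 0"
  shows "card {H\<in>span_sets (d + 1) k. \<forall>h\<in>H. prime (int n + h)}
         = (if prime (n + 1) \<and> prime (n + 1 + d) then card (inner_primes d n) choose k else 0)"
proof (cases "prime (n + 1) \<and> prime (n + 1 + d)")
  case True
  hence pr: "prime (int n + 1)" "prime (int n + int (d + 1))"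
    using prime_int_plus[of n 1] prime_int_plus[of n "d + 1"] by (simp_all add: algebra_simps)
  let ?e = "{1, int (d + 1)}"
  have ends: "?e \<inter> inner_primes d n = {}" by (auto simp: inner_primes_def)
  have "bij_betw (\<lambda>B. ?e \<union> B) {B. B \<subseteq> inner_primes d n \<and> card B = k}
          {H\<in>span_sets (d + 1) k. \<forall>h\<in>H. prime (int n + h)}"
  proof (rule bij_betw_byWitness[where f' = "\<lambda>H. H - ?e"])
    show "\<forall>B\<in>{B. B \<subseteq> inner_primes d n \<and> card B = k}. (?e \<union> B) - ?e = B" using ends by blast
    show "\<forall>H\<in>{H\<in>span_sets (d + 1) k. \<forall>h\<in>H. prime (int n + h)}. ?e \<union> (H - ?e) = H"
      by (auto simp: span_sets_def)
    show "(\<lambda>B. ?e \<union> B) ` {B. B \<subseteq> inner_primes d n \<and> card B = k}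
          \<subseteq> {H\<in>span_sets (d + 1) k. \<forall>h\<in>H. prime (int n + h)}"
    proof clarify
      fix B assume B: "B \<subseteq> inner_primes d n" "k = card B"
      have fB: "finite B" using B(1) finite_inner_primes by (rule finite_subset)
      have "card (?e \<union> B) = card ?e + card B"
        using fB ends B(1) by (intro card_Un_disjoint) auto
      hence "card (?e \<union> B) = card B + 2" using assms by simp
      moreover have "?e \<union> B \<subseteq> {1..int (d + 1)}" using B(1) by (auto simp: inner_primes_def)
      moreover have "\<forall>h\<in>?e \<union> B. prime (int n + h)" using B(1) pr by (auto simp: inner_primes_def)
      ultimately show "?e \<union> B \<in> span_sets (d + 1) (card B) \<and> (\<forall>h\<in>?e \<union> B. prime (int n + h))"
        unfolding span_sets_def by blast
    qed
    show "(\<lambda>H. H - ?e) ` {H\<in>span_sets (d + 1) k. \<forall>h\<in>H. prime (int n + h)}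
          \<subseteq> {B. B \<subseteq> inner_primes d n \<and> card B = k}"
    proof clarify
      fix H assume H: "H \<in> span_sets (d + 1) k" "\<forall>h\<in>H. prime (int n + h)"
      note * = span_setsD[OF H(1)]
      have "card (H - ?e) = card H - card ?e" using * by (intro card_Diff_subset) auto
      hence "card (H - ?e) = k" using *(2) assms by simp
      moreover have "H - ?e \<subseteq> inner_primes d n"
      proof
        fix h assume h: "h \<in> H - ?e"
        hence "1 \<le> h" "h \<le> int (d + 1)" "h \<noteq> 1" "h \<noteq> int (d + 1)" using *(3) by auto
        thus "h \<in> inner_primes d n" using h H(2) by (auto simp: inner_primes_def)
      qed
      ultimately show "H - ?e \<subseteq> inner_primes d n \<and> card (H - ?e) = k" by blast
    qed
  qed
  from bij_betw_same_card[OF this] True show ?thesis by (simp add: n_subsets)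
next
  case False
  have "\<not> (\<forall>h\<in>H. prime (int n + h))" if H: "H \<in> span_sets (d + 1) k" for H
  proof
    assume "\<forall>h\<in>H. prime (int n + h)"
    hence "prime (int n + int 1)" "prime (int n + int (d + 1))" using span_setsD(4,5)[OF H] by auto
    hence "prime (n + 1)" "prime (n + (d + 1))" unfolding prime_int_plus .
    thus False using False by (simp add: algebra_simps)
  qed
  hence "{H\<in>span_sets (d + 1) k. \<forall>h\<in>H. prime (int n + h)} = {}" by blast
  thus ?thesis by (simp only: if_not_P[OF False] card.empty)
qed

text \<open>Exchanging the summations over sets and positions shows that \<open>tuple_sum\<close> is
  a binomial moment: the \<open>k\<close>-th one of the number of primes inside a prime pair at
  distance \<open>d\<close>.\<close>

lemma tuple_sum_eq:
  assumes "d > 0"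
  shows "tuple_sum x d k = (\<Sum>n\<in>pair_positions x d. real (card (inner_primes d n) choose k))"
proof -
  let ?I = "{n::nat. n \<ge> 1 \<and> real n \<le> x}"
  have "tuple_sum x d k
      = (\<Sum>H\<in>span_sets (d + 1) k. \<Sum>n\<in>?I. if \<forall>h\<in>H. prime (int n + h) then 1 else 0)"
    unfolding tuple_sum_def
  proof (intro sum.cong refl)
    fix H
    have "tuple_count x H = card {n\<in>?I. \<forall>h\<in>H. prime (int n + h)}"
      unfolding tuple_count_def by (rule arg_cong[where f = card]) auto
    thus "real (tuple_count x H) = (\<Sum>n\<in>?I. if \<forall>h\<in>H. prime (int n + h) then 1 else 0)"
      by (simp only: real_card_filter[OF finite_nat_le_real])
  qed
  also have "\<dots> = (\<Sum>n\<in>?I. \<Sum>H\<in>span_sets (d + 1) k. if \<forall>h\<in>H. prime (int n + h) then 1 else 0)"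
    by (rule sum.swap)
  also have "\<dots> = (\<Sum>n\<in>?I. real (card {H\<in>span_sets (d + 1) k. \<forall>h\<in>H. prime (int n + h)}))"
    by (intro sum.cong refl real_card_filter[symmetric] finite_span_sets)
  also have "\<dots> = (\<Sum>n\<in>?I. if prime (n + 1) \<and> prime (n + 1 + d)
                            then real (card (inner_primes d n) choose k) else 0)"
    unfolding card_span_sets_all_prime[OF assms] by (intro sum.cong refl) simp
  also have "\<dots> = (\<Sum>n\<in>pair_positions x d. real (card (inner_primes d n) choose k))"
    unfolding pair_positions_def
    by (subst sum.inter_filter[OF finite_nat_le_real, symmetric]) (rule sum.cong, auto)
  finally show ?thesis .
qed

text \<open>Pascal's rule makes the sum telescope.\<close>

lemma alternating_choose_sum:
  "(\<Sum>j\<le>m. (-1) ^ j * real (Suc b choose j)) = (-1) ^ m * real (b choose m)"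
  by (induction m) (auto simp: algebra_simps)

text \<open>For positive \<open>b\<close> the sum cut off at \<open>n\<close> is
  \<open>(-1)^n\<close> times a binomial coefficient, so its sign is that of the last term; for
  \<open>b = 0\<close> it is 1.\<close>

lemma bonferroni:
  "(\<Sum>j\<le>2 * m + 1. (-1) ^ j * real (b choose j)) \<le> (if b = 0 then 1 else 0)"
  "(if b = 0 then 1 else 0) \<le> (\<Sum>j\<le>2 * m. (-1) ^ j * real (b choose j))"
proof -
  have z: "(\<Sum>j\<le>n. (-1) ^ j * real (0 choose j)) = 1" for n
    by (induction n) auto
  show "(\<Sum>j\<le>2 * m + 1. (-1) ^ j * real (b choose j)) \<le> (if b = 0 then 1 else 0)"
    by (cases b) (simp_all only: z alternating_choose_sum, simp_all)
  show "(if b = 0 then 1 else 0) \<le> (\<Sum>j\<le>2 * m. (-1) ^ j * real (b choose j))"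
    by (cases b) (simp_all only: z alternating_choose_sum, simp_all)
qed

definition isolated_positions :: "real \<Rightarrow> nat \<Rightarrow> nat set" where
  "isolated_positions x d = {n\<in>pair_positions x d. inner_primes d n = {}}"

text \<open>The Bonferroni inequalities are taken with \<open>b\<close> the number of inner primes
  and summed over all prime pairs, which turns the binomial coefficients into
  \<open>tuple_sum\<close>.\<close>

lemma isolated_positions_bounds:
  assumes "d > 0"
  shows "(\<Sum>j\<le>2 * m + 1. (-1) ^ j * tuple_sum x d j) \<le> card (isolated_positions x d)"
    and "card (isolated_positions x d) \<le> (\<Sum>j\<le>2 * m. (-1) ^ j * tuple_sum x d j)"
proof -
  have card: "real (card (isolated_positions x d))
      = (\<Sum>n\<in>pair_positions x d. if card (inner_primes d n) = 0 then 1 else 0)"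
    by (simp add: isolated_positions_def sum.inter_filter[symmetric])
  have swap: "(\<Sum>j\<le>M. (-1) ^ j * tuple_sum x d j)
      = (\<Sum>n\<in>pair_positions x d. \<Sum>j\<le>M. (-1) ^ j * real (card (inner_primes d n) choose j))" for M
    unfolding tuple_sum_eq[OF assms] sum_distrib_left by (rule sum.swap)
  show "(\<Sum>j\<le>2 * m + 1. (-1) ^ j * tuple_sum x d j) \<le> card (isolated_positions x d)"
    unfolding card swap by (intro sum_mono bonferroni)
  show "card (isolated_positions x d) \<le> (\<Sum>j\<le>2 * m. (-1) ^ j * tuple_sum x d j)"
    unfolding card swap by (intro sum_mono bonferroni)
qed

section \<open>Gap counts and isolated prime pairs\<close>

lemma consecutive_nth_primes_iff:
  assumes "p < q"
  shows "(\<exists>n\<ge>1. nth_prime n = p \<and> nth_prime (n + 1) = q)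
         \<longleftrightarrow> prime p \<and> prime q \<and> (\<forall>r. p < r \<and> r < q \<longrightarrow> \<not> prime r)"
proof -
  let ?P = "{p::nat. prime p}"
  have inf: "infinite ?P" by (rule primes_infinite)
  have ex: "\<exists>i. enumerate ?P i = r" if "prime r" for r using enumerate_Ex[of ?P r] that inf by simp
  show ?thesis
  proof
    assume "\<exists>n\<ge>1. nth_prime n = p \<and> nth_prime (n + 1) = q"
    then obtain n where n: "n \<ge> 1" "nth_prime n = p" "nth_prime (n + 1) = q" by blast
    have p: "p = enumerate ?P (n - 1)" and q: "q = enumerate ?P n" using n by (simp_all add: nth_prime_def)
    have "prime p" "prime q" using enumerate_in_set[OF inf] unfolding p q by auto
    moreover have "\<not> prime r" if r: "p < r" "r < q" for r
    proof
      assume "prime r"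
      then obtain i where i: "enumerate ?P i = r" using ex by blast
      hence "n - 1 < i" "i < n" using r inf unfolding p q i[symmetric] by simp_all
      thus False by simp
    qed
    ultimately show "prime p \<and> prime q \<and> (\<forall>r. p < r \<and> r < q \<longrightarrow> \<not> prime r)" by blast
  next
    assume *: "prime p \<and> prime q \<and> (\<forall>r. p < r \<and> r < q \<longrightarrow> \<not> prime r)"
    then obtain i j where ij: "enumerate ?P i = p" "enumerate ?P j = q" using ex by blast
    have "i < j" using assms inf unfolding ij[symmetric] by simp
    moreover have "\<not> Suc i < j"
    proof
      assume "Suc i < j"
      hence "enumerate ?P (Suc i) < q" "p < enumerate ?P (Suc i)"
        using inf unfolding ij[symmetric] by simp_all
      thus False using * enumerate_in_set[OF inf, of "Suc i"] by auto
    qed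
    ultimately have "j = Suc i" by simp
    \<comment> \<open>\<open>enumerate\<close> starts at 0 and \<open>nth_prime\<close> at 1, so
      index \<open>i\<close> of the former is index \<open>Suc i\<close> of the latter.\<close>
    thus "\<exists>n\<ge>1. nth_prime n = p \<and> nth_prime (n + 1) = q"
      using ij by (intro exI[of _ "Suc i"]) (simp add: nth_prime_def)
  qed
qed

lemma inner_primes_empty_iff:
  "inner_primes d n = {} \<longleftrightarrow> (\<forall>r. n + 1 < r \<and> r < n + 1 + d \<longrightarrow> \<not> prime r)"
proof
  assume e: "inner_primes d n = {}"
  show "\<forall>r. n + 1 < r \<and> r < n + 1 + d \<longrightarrow> \<not> prime r"
  proof (intro allI impI notI)
    fix r assume r: "n + 1 < r \<and> r < n + 1 + d" "prime r"
    hence "int r - int n \<in> inner_primes d n" by (auto simp: inner_primes_def)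
    with e show False by simp
  qed
next
  assume r: "\<forall>r. n + 1 < r \<and> r < n + 1 + d \<longrightarrow> \<not> prime r"
  show "inner_primes d n = {}"
  proof (rule equals0I)
    fix h assume "h \<in> inner_primes d n"
    hence h: "2 \<le> h" "h \<le> int d" "prime (int n + h)" by (auto simp: inner_primes_def)
    hence "prime (n + nat h)" using prime_int_plus[of n "nat h"] by simp
    moreover have "n + 1 < n + nat h" "n + nat h < n + 1 + d" using h by linarith+
    ultimately show False using r by blast
  qed
qed

lemma gap_count_eq:
  assumes "d > 0"
  shows "gap_count x d
    = card {n. prime (n + 1) \<and> prime (n + 1 + d) \<and> inner_primes d n = {} \<and> real (n + 1 + d) \<le> x}"
proof -
  let ?M = "{m. m \<ge> 1 \<and> real (nth_prime (m + 1)) \<le> x \<and> int (nth_prime (m + 1)) - int (nth_prime m) = int d}"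
  let ?G = "{n. prime (n + 1) \<and> prime (n + 1 + d) \<and> inner_primes d n = {} \<and> real (n + 1 + d) \<le> x}"
  have pr: "prime (nth_prime m)" for m
    using enumerate_in_set[OF primes_infinite, of "m - 1"] by (simp add: nth_prime_def)
  have inj: "inj_on (\<lambda>m. nth_prime m - 1) ?M"
  proof (rule inj_onI)
    fix m m' assume m: "m \<in> ?M" "m' \<in> ?M" "nth_prime m - 1 = nth_prime m' - 1"
    hence "nth_prime m = nth_prime m'"
      using prime_gt_0_nat[OF pr[of m]] prime_gt_0_nat[OF pr[of m']] by linarith
    hence "m - 1 = m' - 1"
      using inj_enumerate[OF primes_infinite] by (simp add: nth_prime_def inj_def)
    \<comment> \<open>Truncated subtraction maps 0 and 1 to the same value; both indices being at
      least 1 restores injectivity.\<close>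
    thus "m = m'" using m(1,2) by auto
  qed
  have "(\<lambda>m. nth_prime m - 1) ` ?M = ?G"
  proof (intro equalityI subsetI)
    fix n assume "n \<in> (\<lambda>m. nth_prime m - 1) ` ?M"
    then obtain m where m: "m \<ge> 1" "real (nth_prime (m + 1)) \<le> x"
      "int (nth_prime (m + 1)) - int (nth_prime m) = int d" "n = nth_prime m - 1" by blast
    have n: "nth_prime m = n + 1" using m(4) prime_gt_0_nat[OF pr[of m]] by simp
    moreover from this m(3) have nd: "nth_prime (m + 1) = n + 1 + d" by linarith
    ultimately have "\<exists>m\<ge>1. nth_prime m = n + 1 \<and> nth_prime (m + 1) = n + 1 + d" using m(1) by blast
    hence "prime (n + 1) \<and> prime (n + 1 + d) \<and> (\<forall>r. n + 1 < r \<and> r < n + 1 + d \<longrightarrow> \<not> prime r)"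
      using assms by (subst (asm) consecutive_nth_primes_iff) auto
    thus "n \<in> ?G" using m(2) nd by (simp add: inner_primes_empty_iff)
  next
    fix n assume n: "n \<in> ?G"
    hence "\<exists>m\<ge>1. nth_prime m = n + 1 \<and> nth_prime (m + 1) = n + 1 + d"
      using assms by (subst consecutive_nth_primes_iff) (auto simp: inner_primes_empty_iff)
    then obtain m where m: "m \<ge> 1" "nth_prime m = n + 1" "nth_prime (m + 1) = n + 1 + d" by blast
    have "m \<in> ?M" using m n by simp
    moreover have "n = nth_prime m - 1" using m by simp
    ultimately show "n \<in> (\<lambda>m. nth_prime m - 1) ` ?M" by blast
  qed
  with card_image[OF inj] show ?thesis by (simp add: gap_count_def)
qed

text \<open>The two counts differ only in the cutoff: \<open>gap_count\<close> requires the larger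
  prime \<open>n + 1 + d\<close> to be at most \<open>x\<close>, the other count only
  \<open>n\<close>. The positions in between lie in an interval of \<open>d + 1\<close>
  integers.\<close>

lemma gap_count_approx:
  assumes "d > 0"
  shows "\<bar>real (gap_count x d) - card (isolated_positions x d)\<bar> \<le> d + 1"
proof -
  let ?G = "{n. prime (n + 1) \<and> prime (n + 1 + d) \<and> inner_primes d n = {} \<and> real (n + 1 + d) \<le> x}"
  let ?M = "isolated_positions x d"
  have fin: "finite ?M" by (simp add: isolated_positions_def)
  have sub: "?G \<subseteq> ?M"
  proof
    fix n assume n: "n \<in> ?G"
    hence "n + 1 \<ge> 2" using prime_ge_2_nat by blast
    with n show "n \<in> ?M" by (auto simp: isolated_positions_def pair_positions_def)
  qed
  have "?M - ?G \<subseteq> {nat \<lfloor>x\<rfloor> - d..nat \<lfloor>x\<rfloor>}"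
  proof
    fix n assume "n \<in> ?M - ?G"
    hence "real n \<le> x" "real (n + 1 + d) > x" by (auto simp: isolated_positions_def pair_positions_def)
    hence "int n \<le> \<lfloor>x\<rfloor>" "\<lfloor>x\<rfloor> < int n + 1 + int d" by linarith+
    thus "n \<in> {nat \<lfloor>x\<rfloor> - d..nat \<lfloor>x\<rfloor>}" by auto
  qed
  hence "card (?M - ?G) \<le> card {nat \<lfloor>x\<rfloor> - d..nat \<lfloor>x\<rfloor>}" by (intro card_mono) auto
  also have "\<dots> \<le> d + 1" by simp
  finally have "card (?M - ?G) \<le> d + 1" .
  moreover have "card (?M - ?G) = card ?M - card ?G" using finite_subset[OF sub fin] sub by (rule card_Diff_subset)
  moreover have "card ?G \<le> card ?M" by (rule card_mono[OF fin sub])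
  ultimately show ?thesis by (simp add: gap_count_eq[OF assms])
qed

text \<open>If \<open>H\<close> meets every class modulo \<open>p\<close>, then for each
  \<open>n\<close> some \<open>n + h\<close> is divisible by \<open>p\<close>. Being prime it equals
  \<open>p\<close>, so \<open>n\<close> is determined by \<open>h\<close>.\<close>

lemma tuple_count_inadmissible_le:
  assumes "finite H" "\<not> admissible H"
  shows "tuple_count x H \<le> card H"
proof -
  obtain p where p: "prime p" "residue_count H p \<ge> p" using assms(2) by (auto simp: admissible_def not_less)
  have p0: "int p > 0" using prime_gt_0_nat[OF p(1)] by simp
  let ?R = "(\<lambda>h. h mod int p) ` H"
  have R: "?R = {0..<int p}"
  proof (rule card_subset_eq)
    show "card ?R = card {0..<int p}"
      using p(2) residue_count_le[of p H] p0 by (simp add: residue_count_def)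
  qed (use p0 in auto)
  have "{n::nat. n \<ge> 1 \<and> real n \<le> x \<and> (\<forall>h\<in>H. prime (int n + h))} \<subseteq> (\<lambda>h. nat (int p - h)) ` H"
  proof
    fix n :: nat assume n: "n \<in> {n::nat. n \<ge> 1 \<and> real n \<le> x \<and> (\<forall>h\<in>H. prime (int n + h))}"
    have "(- int n) mod int p \<in> ?R" unfolding R using p0 by simp
    then obtain h where h: "h \<in> H" "(- int n) mod int p = h mod int p" by blast
    hence "int p dvd - int n - h" by (simp add: mod_eq_dvd_iff)
    hence "int p dvd - (- int n - h)" by (simp only: dvd_minus_iff)
    hence "int p dvd int n + h" by (simp add: add.commute)
    moreover have "prime (int n + h)" "prime (int p)" using n h p(1) by auto
    ultimately have "int p = int n + h" by (metis primes_dvd_imp_eq)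
    hence "n = nat (int p - h)" by simp
    thus "n \<in> (\<lambda>h. nat (int p - h)) ` H" using h(1) by blast
  qed
  hence "tuple_count x H \<le> card ((\<lambda>h. nat (int p - h)) ` H)"
    unfolding tuple_count_def using assms(1) by (intro card_mono) auto
  also have "\<dots> \<le> card H" using assms(1) by (rule card_image_le)
  finally show ?thesis .
qed

section \<open>Asymptotics\<close>

text \<open>The conjecture speaks of admissible sets only; the added \<open>card H\<close> covers
  the others, whose singular series is 0 and whose count is at most \<open>card H\<close>. One bound
  then serves for the whole sum over sets.\<close>

lemma tuple_count_conjecture_error:
  assumes "finite H" "x > 1" "\<eta> \<ge> 0"
    and "admissible H \<Longrightarrow> \<exists>\<delta>. \<bar>\<delta>\<bar> \<le> \<eta> \<and>
           real (tuple_count x H) = singular_series H * (x / ln x ^ k) * (1 + \<delta>)"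
  shows "\<bar>real (tuple_count x H) - singular_series H * (x / ln x ^ k)\<bar>
         \<le> \<eta> * (singular_series H * (x / ln x ^ k)) + card H"
proof (cases "admissible H")
  case True
  define Z where "Z = singular_series H * (x / ln x ^ k)"
  have "x / ln x ^ k \<ge> 0" using assms(2) by simp
  hence Z: "Z \<ge> 0" unfolding Z_def by (intro mult_nonneg_nonneg singular_series_nonneg assms(1))
  obtain \<delta> where \<delta>: "\<bar>\<delta>\<bar> \<le> \<eta>" "real (tuple_count x H) = Z * (1 + \<delta>)"
    using assms(4)[OF True] unfolding Z_def by blast
  have "\<bar>real (tuple_count x H) - Z\<bar> = \<bar>\<delta>\<bar> * Z" using Z \<delta>(2) by (simp add: algebra_simps abs_mult)
  also have "\<dots> \<le> \<eta> * Z" using \<delta>(1) Z by (rule mult_right_mono)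
  finally show ?thesis unfolding Z_def by simp
next
  case False
  thus ?thesis using singular_series_eq_0[OF assms(1) False] tuple_count_inadmissible_le[OF assms(1) False, of x]
    by simp
qed

lemma ln_power_div_tendsto_0: "((\<lambda>x::real. ln x ^ m / x) \<longlongrightarrow> 0) at_top"
proof -
  have "((\<lambda>x::real. ln x ^ m / exp (ln x)) \<longlongrightarrow> 0) at_top"
    by (rule filterlim_compose[OF tendsto_power_div_exp_0 ln_at_top])
  moreover have "\<forall>\<^sub>F x::real in at_top. ln x ^ m / exp (ln x) = ln x ^ m / x"
    using eventually_gt_at_top[of 0] by eventually_elim simp
  ultimately show ?thesis by (simp cong: tendsto_cong)
qed

section \<open>Limits along a given gap function\<close>

locale gap_setting =
  fixes lam :: real and d :: "real \<Rightarrow> nat"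
  assumes lam_pos: "lam > 0"
    and conj: "conjecture_H lam"
    and d_pos: "\<And>x. d x > 0" and d_even: "\<And>x. even (d x)"
    and d_asymp: "(\<lambda>x. real (d x)) \<sim>[at_top] (\<lambda>x. lam * ln x)"
begin

text \<open>The predicted number of all prime pairs at distance \<open>d x\<close>, consecutive or
  not; the theorem says that a proportion \<open>exp (- lam)\<close> of them is consecutive.\<close>

definition scale :: "real \<Rightarrow> real" where
  "scale x = pair_singular_series (d x) * (x / (ln x)\<^sup>2)"

lemma pair_series_pos: "pair_singular_series (d x) > 0"
  using pair_singular_series_ge[OF d_even[of x]] twin_prime_const_pos by linarith

lemma scale_pos: "x > 1 \<Longrightarrow> scale x > 0"
  unfolding scale_def by (intro mult_pos_pos pair_series_pos divide_pos_pos) auto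

lemma d_over_ln: "((\<lambda>x. real (d x + 1) / ln x) \<longlongrightarrow> lam) at_top"
proof -
  have "((\<lambda>x. real (d x) / (lam * ln x)) \<longlongrightarrow> 1) at_top"
  proof (rule asymp_equivD_strong[OF d_asymp], intro always_eventually allI disjI1)
    fix x show "real (d x) \<noteq> 0" using d_pos[of x] by simp
  qed
  hence "((\<lambda>x. lam * (real (d x) / (lam * ln x)) + 1 / ln x) \<longlongrightarrow> lam * 1 + 0) at_top"
    by (intro tendsto_intros real_tendsto_divide_at_top[OF tendsto_const ln_at_top])
  moreover have "lam * (real (d x) / (lam * ln x)) + 1 / ln x = real (d x + 1) / ln x" for x
    using lam_pos by (simp add: add_divide_distrib)
  ultimately show ?thesis by simp
qed

text \<open>The tuples lie in \<open>[1, d x + 1]\<close>, so the conjecture is applied with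
  \<open>d x + 1\<close> as its function \<open>h\<close>.\<close>

lemma window_asymp: "(\<lambda>x. real (d x + 1)) \<sim>[at_top] (\<lambda>x. lam * ln x)"
proof (rule asymp_equivI')
  have "((\<lambda>x. real (d x + 1) / ln x / lam) \<longlongrightarrow> lam / lam) at_top"
    using lam_pos by (intro tendsto_intros d_over_ln) auto
  thus "((\<lambda>x. real (d x + 1) / (lam * ln x)) \<longlongrightarrow> 1) at_top"
    using lam_pos by (simp add: mult.commute)
qed

lemma window_at_top: "filterlim (\<lambda>x. d x + 1) at_top at_top"
proof -
  have "filterlim (\<lambda>x. real (d x + 1) / ln x * ln x) at_top at_top"
    by (rule filterlim_tendsto_pos_mult_at_top[OF d_over_ln lam_pos ln_at_top])
  moreover have "\<forall>\<^sub>F x in at_top. real (d x + 1) / ln x * ln x = real (d x + 1)"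
    using eventually_gt_at_top[of "1::real"] by eventually_elim simp
  ultimately have "filterlim (\<lambda>x. real (d x + 1)) at_top at_top"
    by (subst (asm) filterlim_cong[OF refl refl]) auto
  thus ?thesis
    unfolding filterlim_at_top by (metis (mono_tags, lifting) eventually_mono of_nat_le_iff)
qed

text \<open>The numerator is of order \<open>(ln x)^k\<close>, while \<open>scale x\<close> is at
  least a positive constant times \<open>x / (ln x)^2\<close>, whatever the value of
  \<open>d x\<close>.\<close>

lemma polynomial_over_scale: "((\<lambda>x. C * real (d x + 1) ^ k / scale x) \<longlongrightarrow> 0) at_top"
proof (rule Lim_null_comparison)
  let ?s = "2 * twin_prime_const"
  have s: "?s > 0" using twin_prime_const_pos by simp
  have "((\<lambda>x. \<bar>C\<bar> / ?s * ((real (d x + 1) / ln x) ^ k * (ln x ^ (k + 2) / x)))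
          \<longlongrightarrow> \<bar>C\<bar> / ?s * (lam ^ k * 0)) at_top"
    by (intro tendsto_intros d_over_ln ln_power_div_tendsto_0)
  thus "((\<lambda>x. \<bar>C\<bar> / ?s * ((real (d x + 1) / ln x) ^ k * (ln x ^ (k + 2) / x))) \<longlongrightarrow> 0) at_top" by simp
  show "\<forall>\<^sub>F x in at_top. norm (C * real (d x + 1) ^ k / scale x)
          \<le> \<bar>C\<bar> / ?s * ((real (d x + 1) / ln x) ^ k * (ln x ^ (k + 2) / x))"
    using eventually_gt_at_top[of 1]
  proof eventually_elim
    case (elim x)
    have pos: "x / (ln x)\<^sup>2 > 0" using elim by simp
    have le: "?s * (x / (ln x)\<^sup>2) \<le> scale x"
      unfolding scale_def by (intro mult_right_mono pair_singular_series_ge d_even less_imp_le[OF pos])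
    have "norm (C * real (d x + 1) ^ k / scale x) = \<bar>C\<bar> * real (d x + 1) ^ k / scale x"
      using scale_pos[OF elim] by (simp add: abs_mult)
    also have "\<dots> \<le> \<bar>C\<bar> * real (d x + 1) ^ k / (?s * (x / (ln x)\<^sup>2))"
      by (rule divide_left_mono[OF le _ mult_pos_pos[OF scale_pos[OF elim] mult_pos_pos[OF s pos]]]) simp
    also have "\<dots> = \<bar>C\<bar> / ?s * ((real (d x + 1) / ln x) ^ k * (ln x ^ (k + 2) / x))"
      using elim s by (simp add: power_divide power_add power2_eq_square field_simps)
    finally show ?case .
  qed
qed

lemma series_average_tendsto:
  "((\<lambda>x. (\<Sum>H\<in>span_sets (d x + 1) k. singular_series H)
          / (pair_singular_series (d x) * real (d x + 1) ^ k)) \<longlongrightarrow> 1 / fact k) at_top"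
proof (rule tendstoI)
  fix \<epsilon> :: real assume \<epsilon>: "\<epsilon> > 0"
  obtain D :: nat where D: "\<And>N. N \<ge> D \<Longrightarrow>
    \<bar>(\<Sum>H\<in>span_sets N k. singular_series H) - real N ^ k / fact k * singular_series {1, int N}\<bar>
    \<le> \<epsilon> / 2 * real N ^ k * singular_series {1, int N}"
    using singular_series_average[of "\<epsilon> / 2" k] \<epsilon> by auto
  have "\<forall>\<^sub>F x in at_top. d x + 1 \<ge> D" using window_at_top by (simp only: filterlim_at_top)
  thus "\<forall>\<^sub>F x in at_top. dist ((\<Sum>H\<in>span_sets (d x + 1) k. singular_series H)
          / (pair_singular_series (d x) * real (d x + 1) ^ k)) (1 / fact k) < \<epsilon>"
  proof eventually_elim
    case (elim x)
    define E where "E = (\<Sum>H\<in>span_sets (d x + 1) k. singular_series H)"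
    define U where "U = pair_singular_series (d x) * real (d x + 1) ^ k"
    have U: "U > 0" unfolding U_def by (intro mult_pos_pos pair_series_pos) simp
    have "\<bar>E - U / fact k\<bar> \<le> \<epsilon> / 2 * U"
      using D[OF elim] unfolding singular_series_pair[OF d_pos d_even] E_def U_def by (simp add: mult_ac)
    moreover have "E / U - 1 / fact k = (E - U / fact k) / U" using U by (simp add: field_simps)
    ultimately have "\<bar>E / U - 1 / fact k\<bar> \<le> \<epsilon> / 2" using U by (simp add: abs_div pos_divide_le_eq)
    thus ?case using \<epsilon> unfolding dist_real_def E_def U_def by linarith
  qed
qed

text \<open>The conjecture for \<open>k + 2\<close> elements replaces each count by its singular
  series, and the average of these is \<open>(d + 1)^k / k!\<close> times the pair series,
  asymptotically. Of the \<open>k + 2\<close> logarithms, \<open>k\<close> turn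
  \<open>(d + 1)^k\<close> into \<open>lam^k\<close> and two remain in \<open>scale\<close>.
  Inadmissible sets add at most \<open>k + 2\<close> for each of at most \<open>(d + 1)^k\<close>
  sets.\<close>

lemma tuple_sum_tendsto:
  "((\<lambda>x. tuple_sum x (d x) k / scale x) \<longlongrightarrow> lam ^ k / fact k) at_top"
proof -
  define E where "E = (\<lambda>x. \<Sum>H\<in>span_sets (d x + 1) k. singular_series H)"
  define L where "L = lam ^ k / fact k"
  define e where "e = (\<lambda>x. E x / (pair_singular_series (d x) * real (d x + 1) ^ k)
                              * (real (d x + 1) / ln x) ^ k)"
  have e_lim: "(e \<longlongrightarrow> L) at_top"
    using tendsto_mult[OF series_average_tendsto[of k] tendsto_power[OF d_over_ln, of k]]
    by (simp add: e_def E_def L_def)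
  have L0: "L \<ge> 0" using lam_pos by (simp add: L_def)
  have "((\<lambda>x. tuple_sum x (d x) k / scale x - e x) \<longlongrightarrow> 0) at_top"
  proof (rule tendstoI)
    fix \<epsilon> :: real assume \<epsilon>: "\<epsilon> > 0"
    \<comment> \<open>Eventually \<open>e x\<close> is below \<open>L + 1\<close>, so the relative
      error of the conjecture costs at most half of \<open>\<epsilon>\<close>.\<close>
    define \<eta> where "\<eta> = \<epsilon> / (2 * (L + 1))"
    have \<eta>: "\<eta> > 0" using \<epsilon> L0 by (simp add: \<eta>_def)
    have ev1: "\<forall>\<^sub>F x in at_top. e x < L + 1" using e_lim by (rule order_tendstoD) simp
    have ev2: "\<forall>\<^sub>F x in at_top. real (k + 2) * real (d x + 1) ^ k / scale x < \<epsilon> / 2"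
      using polynomial_over_scale by (rule order_tendstoD) (use \<epsilon> in simp)
    have ev3: "\<forall>\<^sub>F x in at_top.
       \<forall>H. finite H \<and> card H = k + 2 \<and> admissible H \<and> (\<forall>a\<in>H. 1 \<le> a \<and> real_of_int a \<le> real (d x + 1)) \<longrightarrow>
         (\<exists>\<delta>. \<bar>\<delta>\<bar> \<le> \<eta> \<and>
            real (tuple_count x H) = singular_series H * (x / ln x ^ (k + 2)) * (1 + \<delta>))"
      using conj window_asymp \<eta> unfolding conjecture_H_def by (meson le_add2)
    show "\<forall>\<^sub>F x in at_top. dist (tuple_sum x (d x) k / scale x - e x) 0 < \<epsilon>"
      using ev1 ev2 ev3 eventually_gt_at_top[of 1]
    proof eventually_elim
      case (elim x)
      let ?N = "d x + 1"
      define Z where "Z = x / ln x ^ (k + 2)"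
      have N2: "?N \<ge> 2" using d_pos[of x] by linarith
      have "\<bar>tuple_sum x (d x) k - E x * Z\<bar>
          = \<bar>\<Sum>H\<in>span_sets ?N k. real (tuple_count x H) - singular_series H * Z\<bar>"
        by (simp add: tuple_sum_def E_def sum_subtractf sum_distrib_right)
      also have "\<dots> \<le> (\<Sum>H\<in>span_sets ?N k. \<bar>real (tuple_count x H) - singular_series H * Z\<bar>)"
        by (rule sum_abs)
      also have "\<dots> \<le> (\<Sum>H\<in>span_sets ?N k. \<eta> * (singular_series H * Z) + real (k + 2))"
      proof (rule sum_mono)
        fix H assume H: "H \<in> span_sets ?N k"
        note * = span_setsD[OF H]
        have rng: "\<forall>a\<in>H. 1 \<le> a \<and> real_of_int a \<le> real ?N"
        proof
          fix a assume "a \<in> H"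
          hence "1 \<le> a" "a \<le> int ?N" using *(3) by auto
          thus "1 \<le> a \<and> real_of_int a \<le> real ?N" by linarith
        qed
        show "\<bar>real (tuple_count x H) - singular_series H * Z\<bar> \<le> \<eta> * (singular_series H * Z) + real (k + 2)"
          using tuple_count_conjecture_error[of H x \<eta> "k + 2"] elim(3,4) rng *(1,2) \<eta>
          unfolding Z_def by auto
      qed
      also have "\<dots> = \<eta> * (E x * Z) + real (k + 2) * real (card (span_sets ?N k))"
        by (simp add: sum.distrib E_def sum_distrib_right sum_distrib_left mult_ac)
      also have "\<dots> \<le> \<eta> * (E x * Z) + real (k + 2) * real ?N ^ k"
        by (intro add_left_mono mult_left_mono card_span_sets_le N2) simp
      finally have main: "\<bar>tuple_sum x (d x) k - E x * Z\<bar> \<le> \<eta> * (E x * Z) + real (k + 2) * real ?N ^ k" .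
      have sc: "scale x > 0" by (rule scale_pos) fact
      have eZ: "E x * Z = e x * scale x"
      proof -
        have "ln x > 0" "pair_singular_series (d x) > 0" "real ?N > 0"
          using elim(4) pair_series_pos by auto
        thus ?thesis using elim(4)
          by (simp add: e_def Z_def scale_def power_divide power_add power2_eq_square)
      qed
      have "tuple_sum x (d x) k / scale x - e x = (tuple_sum x (d x) k - E x * Z) / scale x"
        using sc by (simp add: eZ diff_divide_distrib)
      hence "\<bar>tuple_sum x (d x) k / scale x - e x\<bar> = \<bar>tuple_sum x (d x) k - E x * Z\<bar> / scale x"
        using sc by (simp add: abs_div)
      also have "\<dots> \<le> (\<eta> * (E x * Z) + real (k + 2) * real ?N ^ k) / scale x"
        using main sc by (intro divide_right_mono) auto
      also have "\<dots> = \<eta> * e x + real (k + 2) * real ?N ^ k / scale x"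
        using sc by (simp add: eZ add_divide_distrib)
      also have "\<dots> < \<eta> * (L + 1) + \<epsilon> / 2"
        using elim(1,2) \<eta> by (intro add_strict_mono mult_strict_left_mono) auto
      also have "\<dots> = \<epsilon>" using L0 by (simp add: \<eta>_def field_simps)
      finally show ?case by (simp add: dist_real_def)
    qed
  qed
  from tendsto_add[OF this e_lim] show ?thesis by (simp add: L_def)
qed

text \<open>The Bonferroni bounds at \<open>2m + 1\<close> and \<open>2m\<close>, divided by
  \<open>scale\<close>, tend to partial sums of the series for \<open>exp (- lam)\<close>. The
  cutoff \<open>m\<close> is fixed before \<open>x\<close> grows, since the conjecture is uniform
  only for fixed tuple size. The three thirds of \<open>\<epsilon>\<close> pay for the difference
  between gap count and isolated positions, for the convergence of the bounds, and for the tail of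
  the series.\<close>

lemma gap_count_tendsto: "((\<lambda>x. real (gap_count x (d x)) / scale x) \<longlongrightarrow> exp (- lam)) at_top"
proof (rule tendstoI)
  fix \<epsilon> :: real assume \<epsilon>: "\<epsilon> > 0"
  define P where "P = (\<lambda>M::nat. \<Sum>j\<le>M. (-1) ^ j * (lam ^ j / fact j))"
  define a where "a = (\<lambda>M x. (\<Sum>j\<le>M. (-1) ^ j * tuple_sum x (d x) j) / scale x)"
  have "(\<lambda>n. (- lam) ^ n /\<^sub>R fact n) sums exp (- lam)" by (rule exp_converges)
  moreover have "(- lam) ^ n /\<^sub>R fact n = (-1) ^ n * (lam ^ n / fact n)" for n
    using power_minus[of lam n] by (simp add: divide_inverse)
  ultimately have "P \<longlonglongrightarrow> exp (- lam)" by (simp add: sums_def_le P_def)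
  hence "\<forall>\<^sub>F M in sequentially. dist (P M) (exp (- lam)) < \<epsilon> / 3" using \<epsilon> by (intro tendstoD) auto
  then obtain m where m: "\<And>M. M \<ge> m \<Longrightarrow> \<bar>P M - exp (- lam)\<bar> < \<epsilon> / 3"
    by (auto simp: eventually_sequentially dist_real_def)
  have a_lim: "(a M \<longlongrightarrow> P M) at_top" for M
  proof -
    have "((\<lambda>x. \<Sum>j\<le>M. (-1) ^ j * (tuple_sum x (d x) j / scale x)) \<longlongrightarrow> P M) at_top"
      unfolding P_def by (intro tendsto_intros tuple_sum_tendsto)
    thus ?thesis by (simp add: a_def sum_divide_distrib)
  qed
  have ev: "\<forall>\<^sub>F x in at_top. \<bar>a M x - P M\<bar> < \<epsilon> / 3" for M
    using tendstoD[OF a_lim[of M], of "\<epsilon> / 3"] \<epsilon> by (simp add: dist_real_def)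
  have ev': "\<forall>\<^sub>F x in at_top. 1 * real (d x + 1) ^ 1 / scale x < \<epsilon> / 3"
    using polynomial_over_scale by (rule order_tendstoD) (use \<epsilon> in simp)
  show "\<forall>\<^sub>F x in at_top. dist (real (gap_count x (d x)) / scale x) (exp (- lam)) < \<epsilon>"
    using ev[of "2 * m"] ev[of "2 * m + 1"] ev' eventually_gt_at_top[of 1]
  proof eventually_elim
    case (elim x)
    have sc: "scale x > 0" by (rule scale_pos) fact
    define g where "g = real (gap_count x (d x))"
    define I where "I = real (card (isolated_positions x (d x)))"
    have gI: "\<bar>g - I\<bar> \<le> real (d x + 1)"
      using gap_count_approx[OF d_pos[of x], where x = x] by (simp add: g_def I_def)
    have "\<bar>g / scale x - I / scale x\<bar> = \<bar>g - I\<bar> / scale x"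
      using sc by (simp add: abs_div flip: diff_divide_distrib)
    also have "\<dots> \<le> real (d x + 1) / scale x" using gI sc by (intro divide_right_mono) auto
    also have "\<dots> < \<epsilon> / 3" using elim(3) by (simp only: power_one_right mult_1_left)
    finally have 1: "\<bar>g / scale x - I / scale x\<bar> < \<epsilon> / 3" .
    have 2: "a (2 * m + 1) x \<le> I / scale x"
      unfolding a_def I_def using isolated_positions_bounds(1)[OF d_pos[of x], where m = m and x = x] sc
      by (intro divide_right_mono) auto
    have 3: "I / scale x \<le> a (2 * m) x"
      unfolding a_def I_def using isolated_positions_bounds(2)[OF d_pos[of x], where m = m and x = x] sc
      by (intro divide_right_mono) auto
    have "\<bar>P (2 * m) - exp (- lam)\<bar> < \<epsilon> / 3" "\<bar>P (2 * m + 1) - exp (- lam)\<bar> < \<epsilon> / 3"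
      by (rule m, simp)+
    with 1 2 3 elim(1,2) have "\<bar>g / scale x - exp (- lam)\<bar> < \<epsilon>" by linarith
    thus ?case by (simp add: g_def dist_real_def)
  qed
qed

end

theorem mainTheorem1:
  fixes lam :: real and d :: "real \<Rightarrow> nat"
  assumes "lam > 0"
    and "conjecture_H lam"
    and "\<And>x. d x > 0 \<and> even (d x)"
    and "(\<lambda>x. real (d x)) \<sim>[at_top] (\<lambda>x. lam * ln x)"
  shows "(\<lambda>x. real (gap_count x (d x)))
           \<sim>[at_top] (\<lambda>x. exp (- lam) * pair_singular_series (d x) * (x / (ln x)\<^sup>2))"
proof -
  interpret gap_setting lam d by unfold_locales (use assms in auto)
  have "((\<lambda>x. real (gap_count x (d x)) / scale x / exp (- lam)) \<longlongrightarrow> exp (- lam) / exp (- lam)) at_top"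
    by (intro tendsto_intros gap_count_tendsto) simp
  thus ?thesis
    by (intro asymp_equivI') (simp add: scale_def mult_ac)
qed


end
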